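(* There exist a Cantor set $E\subset[0,1]^2$ and a positive Radon probability measure $\omega$ on $\mathbb{R}^2$ associated with $E$ (in the sense that $\omega(E)=1$) such that $\omega\in M^{\log,1}$ but $\omega\notin H^{-1}_{loc}(\mathbb{R}^2)$.
   Context: Let $\mathcal{M}$ denote the space of (signed) Radon measures on $\mathbb{R}^2$, and for $\omega\in\mathcal{M}$ let $|\omega|(Q)$ denote the total variation of $\omega$ in $Q$. For $\alpha>0$, the log-Morrey space $M^{\log,\alpha}$ is the set of $\omega\in\mathcal{M}$ with $$\|\omega\|_{M^{\log,\alpha}}=\sup_Q\,\bigl(1-(\log|Q|)_-\bigr)^{\alpha}\,|\omega|(Q)<\infty,$$ where the supremum runs over all cubes (squares) $Q\subset\mathbb{R}^2$ with sides parallel to the coordinate axes, $|Q|$ is the Lebesgue measure of $Q$, and $(t)_-=\min\{t,0\}$. $H^{-1}_{loc}(\mathbb{R}^2)$ is the space of distributions $\omega$ with $\varphi\omega\in H^{-1}(\mathbb{R}^2)$ for every $\varphi\in C_c^\infty(\mathbb{R}^2)$, where $H^{-1}$ is the dual of the Sobolev space $H^1(\mathbb{R}^2)$. A Cantor set is a nonempty compact, perfect, totally disconnected set. *)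

theory Defs
  imports "HOL-Probability.Probability_Measure"
begin

section \<open>Cantor sets\<close>

definition cantor_set :: "'a::topological_space set \<Rightarrow> bool" where
  "cantor_set E \<longleftrightarrow>
     E \<noteq> {} \<and> compact E \<and> (\<forall>x\<in>E. x islimpt E) \<and>
     (\<forall>C. C \<subseteq> E \<and> connected C \<longrightarrow> (\<exists>x. C \<subseteq> {x}))"

section \<open>Radon measures and log-Morrey spaces\<close>

definition radon_measure :: "(real^2) measure \<Rightarrow> bool" where
  "radon_measure M \<longleftrightarrow>
     sets M = sets borel \<and>
     (\<forall>K. compact K \<longrightarrow> emeasure M K < \<infinity>) \<and>
     (\<forall>B\<in>sets borel. emeasure M B = (SUP K\<in>{K. K \<subseteq> B \<and> compact K}. emeasure M K))"

text \<open>
  A signed Radon measure on the plane need not have a value on unbounded sets (both its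
  positive and its negative part may be infinite), so it is represented by its values on bounded
  Borel sets, on which it is real-valued and countably additive. Values of the function on other
  sets are irrelevant. Regularity is automatic in the plane. A positive Radon measure \<open>M\<close>
  is regarded as the signed one \<open>measure M\<close>.
\<close>

definition signed_radon_measure :: "((real^2) set \<Rightarrow> real) \<Rightarrow> bool" where
  "signed_radon_measure \<nu> \<longleftrightarrow>
     (\<forall>A :: nat \<Rightarrow> (real^2) set.
        range A \<subseteq> sets borel \<and> disjoint_family A \<and> bounded (\<Union>n. A n)
        \<longrightarrow> (\<lambda>n. \<nu> (A n)) sums \<nu> (\<Union>n. A n))"

definition total_variation :: "((real^2) set \<Rightarrow> real) \<Rightarrow> (real^2) set \<Rightarrow> ennreal" where
  "total_variation \<nu> Q =
     (SUP P \<in> {P. finite P \<and> disjoint P \<and> (\<forall>A\<in>P. A \<in> sets borel \<and> bounded A \<and> A \<subseteq> Q)}.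
        \<Sum>A\<in>P. ennreal \<bar>\<nu> A\<bar>)"

definition squares :: "(real^2) set set" where
  "squares = {cbox a (a + vec l) | a l. l > 0}"

definition log_morrey_norm :: "real \<Rightarrow> ((real^2) set \<Rightarrow> real) \<Rightarrow> ennreal" where
  "log_morrey_norm \<alpha> \<nu> =
     (SUP Q\<in>squares.
        ennreal ((1 - min (ln (measure lborel Q)) 0) powr \<alpha>) * total_variation \<nu> Q)"

definition log_morrey :: "real \<Rightarrow> ((real^2) set \<Rightarrow> real) set" where
  "log_morrey \<alpha> = {\<nu>. signed_radon_measure \<nu> \<and> log_morrey_norm \<alpha> \<nu> < \<infinity>}"

section \<open>Test functions and distributions\<close>

definition partial :: "2 \<Rightarrow> (real^2 \<Rightarrow> real) \<Rightarrow> real^2 \<Rightarrow> real" where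
  "partial i f x = frechet_derivative f (at x) (axis i 1)"

definition partials :: "2 list \<Rightarrow> (real^2 \<Rightarrow> real) \<Rightarrow> real^2 \<Rightarrow> real" where
  "partials is f = foldr partial is f"

definition test_functions :: "(real^2 \<Rightarrow> real) set" where
  "test_functions =
     {f. (\<forall>is x. partials is f differentiable (at x)) \<and> compact (closure {x. f x \<noteq> 0})}"

text \<open>
  Distributions are functionals whose values outside the test functions are irrelevant.
\<close>

definition distribution :: "((real^2 \<Rightarrow> real) \<Rightarrow> real) \<Rightarrow> bool" where
  "distribution T \<longleftrightarrow>
     (\<forall>f\<in>test_functions. \<forall>g\<in>test_functions. \<forall>a b.
        T (\<lambda>x. a * f x + b * g x) = a * T f + b * T g) \<and>
     (\<forall>K. compact K \<longrightarrow> (\<exists>C N. \<forall>f\<in>test_functions. closure {x. f x \<noteq> 0} \<subseteq> K \<longrightarrow>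
        \<bar>T f\<bar> \<le> C * (\<Sum>is | length is \<le> N. SUP x. \<bar>partials is f x\<bar>)))"

definition distr_mult ::
    "(real^2 \<Rightarrow> real) \<Rightarrow> ((real^2 \<Rightarrow> real) \<Rightarrow> real) \<Rightarrow> (real^2 \<Rightarrow> real) \<Rightarrow> real" where
  "distr_mult \<phi> T = (\<lambda>\<psi>. T (\<lambda>x. \<phi> x * \<psi> x))"

definition distr_of_measure :: "(real^2) measure \<Rightarrow> (real^2 \<Rightarrow> real) \<Rightarrow> real" where
  "distr_of_measure M = (\<lambda>\<psi>. \<integral>x. \<psi> x \<partial>M)"

section \<open>The Sobolev space and its dual\<close>

definition L2 :: "(real^2 \<Rightarrow> 'b::euclidean_space) set" where
  "L2 = {u \<in> borel_measurable lborel. integrable lborel (\<lambda>x. (norm (u x))\<^sup>2)}"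

definition weak_gradient :: "(real^2 \<Rightarrow> real) \<Rightarrow> (real^2 \<Rightarrow> real^2) \<Rightarrow> bool" where
  "weak_gradient u g \<longleftrightarrow>
     (\<forall>\<phi>\<in>test_functions. \<forall>i.
        (\<integral>x. u x * partial i \<phi> x \<partial>lborel) = - (\<integral>x. g x $ i * \<phi> x \<partial>lborel))"

definition H1 :: "(real^2 \<Rightarrow> real) set" where
  "H1 = {u \<in> L2. \<exists>g\<in>L2. weak_gradient u g}"

text \<open>
  The weak gradient of \<open>u\<close> in \<open>L2\<close> is unique almost everywhere; the norm of
  \<open>u\<close> in \<open>H1\<close> is \<open>H1_norm u g\<close> for any version \<open>g\<close> of that
  gradient. Elements of \<open>H1\<close> are functions rather than classes of functions; a bounded
  linear functional respects equality almost everywhere.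
\<close>

definition H1_norm :: "(real^2 \<Rightarrow> real) \<Rightarrow> (real^2 \<Rightarrow> real^2) \<Rightarrow> real" where
  "H1_norm u g = sqrt ((\<integral>x. (u x)\<^sup>2 \<partial>lborel) + (\<integral>x. (norm (g x))\<^sup>2 \<partial>lborel))"

definition H1_dual :: "((real^2 \<Rightarrow> real) \<Rightarrow> real) set" where
  "H1_dual =
     {L. (\<forall>u\<in>H1. \<forall>v\<in>H1. \<forall>a b. L (\<lambda>x. a * u x + b * v x) = a * L u + b * L v) \<and>
         (\<exists>C. \<forall>u\<in>H1. \<forall>g\<in>L2. weak_gradient u g \<longrightarrow> \<bar>L u\<bar> \<le> C * H1_norm u g)}"

definition H_minus1 :: "((real^2 \<Rightarrow> real) \<Rightarrow> real) set" where
  "H_minus1 = {S. \<exists>L\<in>H1_dual. \<forall>\<psi>\<in>test_functions. S \<psi> = L \<psi>}"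

definition H_minus1_loc :: "((real^2 \<Rightarrow> real) \<Rightarrow> real) set" where
  "H_minus1_loc = {T. distribution T \<and> (\<forall>\<phi>\<in>test_functions. distr_mult \<phi> T \<in> H_minus1)}"

text \<open>
  Consistency of the representations: a finite Borel measure is a Radon measure, it is a signed
  Radon measure equal to its own total variation, and it induces a distribution.
\<close>

lemma radon_measure_finite:
  assumes "finite_measure M" "sets M = sets borel"
  shows "radon_measure M"
  unfolding radon_measure_def
proof (intro conjI allI impI ballI)
  interpret finite_measure M by fact
  show "emeasure M K < \<infinity>" for K
    by (simp add: emeasure_eq_measure)
  show "emeasure M B = (SUP K\<in>{K. K \<subseteq> B \<and> compact K}. emeasure M K)"
    if "B \<in> sets borel" for B
    by (rule inner_regular) (use assms that in simp_all)
qed (fact assms)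

lemma signed_radon_measure_measure:
  assumes "finite_measure M" "sets M = sets borel"
  shows "signed_radon_measure (measure M)"
proof -
  interpret finite_measure M by fact
  show ?thesis
    unfolding signed_radon_measure_def
    using finite_measure_UNION assms(2) by auto
qed

lemma total_variation_measure:
  assumes "finite_measure M" "sets M = sets borel" "Q \<in> sets borel" "bounded Q"
  shows "total_variation (measure M) Q = emeasure M Q"
proof -
  interpret finite_measure M by fact
  show ?thesis
    unfolding total_variation_def
  proof (rule antisym)
    show "(SUP P \<in> {P. finite P \<and> disjoint P \<and>
            (\<forall>A\<in>P. A \<in> sets borel \<and> bounded A \<and> A \<subseteq> Q)}.
            \<Sum>A\<in>P. ennreal \<bar>measure M A\<bar>) \<le> emeasure M Q"
    proof (rule SUP_least, clarify)
      fix P assume P: "finite P" "disjoint P"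
        "\<forall>A\<in>P. A \<in> sets borel \<and> bounded A \<and> A \<subseteq> Q"
      have "(\<Sum>A\<in>P. ennreal \<bar>measure M A\<bar>) = (\<Sum>A\<in>P. emeasure M A)"
        by (simp add: emeasure_eq_measure)
      also have "\<dots> = emeasure M (\<Union>A\<in>P. A)"
        using P assms(2)
        by (intro sum_emeasure) (auto simp: disjoint_def disjoint_family_on_def)
      also have "\<dots> \<le> emeasure M Q"
        using P assms by (intro emeasure_mono) auto
      finally show "(\<Sum>A\<in>P. ennreal \<bar>measure M A\<bar>) \<le> emeasure M Q" .
    qed
    show "emeasure M Q \<le> (SUP P \<in> {P. finite P \<and> disjoint P \<and>
            (\<forall>A\<in>P. A \<in> sets borel \<and> bounded A \<and> A \<subseteq> Q)}.
            \<Sum>A\<in>P. ennreal \<bar>measure M A\<bar>)"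
      by (rule SUP_upper2[of "{Q}"])
         (use assms in \<open>auto simp: emeasure_eq_measure disjoint_def\<close>)
  qed
qed

lemma continuous_partials:
  assumes "f \<in> test_functions"
  shows "continuous_on UNIV (partials is f)"
  using assms by (auto simp: test_functions_def continuous_on_eq_continuous_within
      intro: differentiable_imp_continuous_within)

lemma continuous_test_function:
  assumes "f \<in> test_functions"
  shows "continuous_on UNIV f"
  using continuous_partials[OF assms, of "[]"] by (simp add: partials_def)

lemma bdd_above_test_function:
  assumes "f \<in> test_functions"
  shows "bdd_above (range (\<lambda>x. \<bar>f x\<bar>))"
proof -
  have "compact (f ` closure {x. f x \<noteq> 0})"
    using assms continuous_test_function[OF assms]
    by (intro compact_continuous_image) (auto simp: test_functions_def intro: continuous_on_subset)
  then obtain B where B: "\<And>x. x \<in> closure {x. f x \<noteq> 0} \<Longrightarrow> \<bar>f x\<bar> \<le> B"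
    by (fastforce dest: compact_imp_bounded simp: bounded_iff)
  have "\<bar>f x\<bar> \<le> max B 0" for x
    using B[of x] closure_subset[of "{x. f x \<noteq> 0}"] by (cases "f x = 0") auto
  then show ?thesis by (auto intro!: bdd_aboveI)
qed

lemma distribution_distr_of_measure:
  assumes "finite_measure M" "sets M = sets borel"
  shows "distribution (distr_of_measure M)"
proof -
  interpret finite_measure M by fact
  have le: "\<bar>f x\<bar> \<le> (SUP x. \<bar>f x\<bar>)" if "f \<in> test_functions" for f x
    using bdd_above_test_function[OF that] by (rule cSUP_upper[rotated]) simp
  have int: "integrable M f" if f: "f \<in> test_functions" for f
  proof (rule integrable_const_bound)
    show "AE x in M. norm (f x) \<le> (SUP x. \<bar>f x\<bar>)"
      using le[OF f] by simp
    have "f \<in> borel_measurable borel"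
      using continuous_test_function[OF f] by (rule borel_measurable_continuous_onI)
    then show "f \<in> borel_measurable M"
      using measurable_cong_sets[OF assms(2) refl] by blast
  qed
  have bound: "\<bar>\<integral>x. f x \<partial>M\<bar> \<le> (SUP x. \<bar>f x\<bar>) * measure M (space M)"
    if f: "f \<in> test_functions" for f
  proof -
    have "\<bar>\<integral>x. f x \<partial>M\<bar> \<le> (\<integral>x. \<bar>f x\<bar> \<partial>M)"
      by (rule integral_abs_bound)
    also have "\<dots> \<le> (\<integral>x. (SUP x. \<bar>f x\<bar>) \<partial>M)"
      using le[OF f] int[OF f] by (intro integral_mono) auto
    finally show ?thesis by (simp add: mult.commute)
  qed
  have "\<exists>C N. \<forall>f\<in>test_functions. closure {x. f x \<noteq> 0} \<subseteq> K \<longrightarrow>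
      \<bar>\<integral>x. f x \<partial>M\<bar> \<le> C * (\<Sum>is | length is \<le> N. SUP x. \<bar>partials is f x\<bar>)" for K
    by (rule exI[of _ "measure M (space M)"], rule exI[of _ 0])
       (use bound in \<open>auto simp: partials_def mult.commute\<close>)
  then show ?thesis
    using int by (auto simp: distribution_def distr_of_measure_def)
qed

end

theory Submission
  imports Defs "HOL-Probability.Infinite_Product_Measure"
begin

text \<open>
  A positive measure of compact support in the dual of the Sobolev space has finite logarithmic
  energy. The log-Morrey condition with exponent one is the borderline at which this energy may
  diverge, and for a Cantor measure that saturates the condition at every generation it does
  diverge, since all generations make comparable contributions.

  The Cantor set lies on a segment. Its points are the sums of the numbers \<open>gap j\<close> over the
  sets of digits that are one, with \<open>gap j = 2 powr (- 16 * 2 ^ j)\<close>, and the measure makes the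
  digits independent fair coin tosses. A square of side about \<open>gap n\<close> meets a bounded number
  of the \<open>2 ^ n\<close> pieces of generation \<open>n\<close>. Its mass is then of order
  \<open>2 powr (- n)\<close>, the reciprocal of the logarithm of its side, and this is the log-Morrey
  bound (\<open>cantor_measure_log_morrey\<close>).

  To show that the measure is not in the local dual space, divergence of the energy is witnessed
  by explicit test functions. In the plane the Dirichlet energy of a smooth bump does not change
  when the bump is dilated. Around each piece of generation \<open>n\<close> there is room for
  \<open>2 ^ n\<close> concentric dyadic bumps whose gradients are supported in disjoint annuli. Their
  average is one on the piece, and its energy is a constant divided by \<open>2 ^ n\<close>; summed over the
  \<open>2 ^ n\<close> pieces this yields a function of bounded energy with integral at least one against the
  measure. The annuli of different generations are disjoint as well, so the sum of the functions
  of the first \<open>N\<close> generations has energy proportional to \<open>N\<close>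
  (\<open>multiscale_bump_gradient\<close>), whereas it is at least \<open>N\<close> on the Cantor set
  (\<open>multiscale_bump_on_cantor_set\<close>). A functional bounded in the Sobolev norm would give at
  most a multiple of \<open>sqrt N\<close>, a contradiction for large \<open>N\<close>.
\<close>

section \<open>A smooth bump on the line\<close>

text \<open>
  Smoothness of a function means \<open>times_differentiable\<close> for every order. Recursion on the order
  turns each closure property into an induction in which the derivative of a product or of a
  reciprocal is an expression in functions of lower order.
\<close>

fun times_differentiable :: "nat \<Rightarrow> (real \<Rightarrow> real) \<Rightarrow> bool" where
  "times_differentiable 0 f \<longleftrightarrow> True"
| "times_differentiable (Suc n) f \<longleftrightarrow>
     (\<exists>f'. (\<forall>x. (f has_real_derivative f' x) (at x)) \<and> times_differentiable n f')"

lemma times_differentiable_SucI: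
  assumes "\<And>x. (f has_real_derivative f' x) (at x)" "times_differentiable n f'"
  shows "times_differentiable (Suc n) f"
  using assms by auto

lemma times_differentiable_Suc_le:
  "times_differentiable (Suc n) f \<Longrightarrow> times_differentiable n f"
proof (induction n arbitrary: f)
  case (Suc n)
  then show ?case by (metis times_differentiable.simps(2))
qed auto

lemma times_differentiable_add:
  "times_differentiable n f \<Longrightarrow> times_differentiable n g \<Longrightarrow> times_differentiable n (\<lambda>x. f x + g x)"
proof (induction n arbitrary: f g)
  case (Suc n)
  then obtain f' g' where "\<And>x. (f has_real_derivative f' x) (at x)" "times_differentiable n f'"
    "\<And>x. (g has_real_derivative g' x) (at x)" "times_differentiable n g'" by auto
  with Suc.IH show ?case
    by (intro times_differentiable_SucI[of _ "\<lambda>x. f' x + g' x"]) (auto intro!: derivative_eq_intros)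
qed auto

lemma times_differentiable_mult:
  "times_differentiable n f \<Longrightarrow> times_differentiable n g \<Longrightarrow> times_differentiable n (\<lambda>x. f x * g x)"
proof (induction n arbitrary: f g)
  case (Suc n)
  then obtain f' g' where fg: "\<And>x. (f has_real_derivative f' x) (at x)" "times_differentiable n f'"
    "\<And>x. (g has_real_derivative g' x) (at x)" "times_differentiable n g'" by auto
  have "times_differentiable n (\<lambda>x. f' x * g x + f x * g' x)"
    using fg Suc.prems[THEN times_differentiable_Suc_le]
    by (intro times_differentiable_add Suc.IH)
  moreover have "((\<lambda>x. f x * g x) has_real_derivative f' x * g x + f x * g' x) (at x)" for x
    by (rule DERIV_mult[OF fg(1) fg(3), THEN DERIV_cong]) (simp add: mult.commute)
  ultimately show ?case by (intro times_differentiable_SucI)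
qed auto

lemma times_differentiable_const: "times_differentiable n (\<lambda>x. c)"
proof (induction n arbitrary: c)
  case (Suc n)
  then show ?case
    by (intro times_differentiable_SucI[of _ "\<lambda>x. 0"]) auto
qed auto

lemma times_differentiable_inverse:
  "times_differentiable n f \<Longrightarrow> (\<And>x. f x \<noteq> 0) \<Longrightarrow> times_differentiable n (\<lambda>x. inverse (f x))"
proof (induction n)
  case (Suc n)
  then obtain f' where f: "\<And>x. (f has_real_derivative f' x) (at x)" "times_differentiable n f'" by auto
  have IH: "times_differentiable n (\<lambda>x. inverse (f x))"
    using Suc.prems(1)[THEN times_differentiable_Suc_le] Suc.prems(2) by (rule Suc.IH)
  have "times_differentiable n (\<lambda>x. (- 1) * (f' x * (inverse (f x) * inverse (f x))))"
    by (intro times_differentiable_mult times_differentiable_const f IH)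
  moreover have "((\<lambda>x. inverse (f x)) has_real_derivative
      (- 1) * (f' x * (inverse (f x) * inverse (f x)))) (at x)" for x
    by (rule DERIV_inverse_fun[OF f(1) Suc.prems(2), THEN DERIV_cong]) simp
  ultimately show ?case by (intro times_differentiable_SucI)
qed auto

lemma times_differentiable_affine:
  "times_differentiable n f \<Longrightarrow> times_differentiable n (\<lambda>x. f (a * x + b))"
proof (induction n arbitrary: f)
  case (Suc n)
  then obtain f' where f: "\<And>x. (f has_real_derivative f' x) (at x)" "times_differentiable n f'" by auto
  have "((\<lambda>x. f (a * x + b)) has_real_derivative f' (a * x + b) * a) (at x)" for x
    by (rule DERIV_chain2[OF f(1)]) (auto intro!: derivative_eq_intros)
  moreover have "times_differentiable n (\<lambda>x. f' (a * x + b) * a)"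
    by (intro times_differentiable_mult times_differentiable_const Suc.IH f)
  ultimately show ?case by (rule times_differentiable_SucI)
qed auto

text \<open>
  For \<open>p = 1\<close> this is the classical smooth function \<open>exp (- 1 / t)\<close> that vanishes
  on the negative half-line. The polynomial factor in \<open>1 / t\<close> makes the family closed under
  differentiation, so that a single induction over the order gives smoothness of all members.
\<close>

definition flat_exp :: "real poly \<Rightarrow> real \<Rightarrow> real" where
  "flat_exp p t = (if t \<le> 0 then 0 else poly p (1 / t) * exp (- (1 / t)))"

lemma poly_exp_tendsto_0: "((\<lambda>s. poly p s * exp (- s)) \<longlongrightarrow> (0::real)) at_top"
proof -
  have "((\<lambda>s. \<Sum>i\<le>degree p. coeff p i * (s ^ i / exp s)) \<longlongrightarrow> (\<Sum>i\<le>degree p. coeff p i * 0)) at_top"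
    by (intro tendsto_intros tendsto_power_div_exp_0)
  moreover have "(\<lambda>s. \<Sum>i\<le>degree p. coeff p i * (s ^ i / exp s)) = (\<lambda>s. poly p s * exp (- s))"
    by (auto simp: poly_altdef exp_minus sum_divide_distrib divide_inverse sum_distrib_right mult.assoc)
  ultimately show ?thesis by simp
qed

text \<open>
  With \<open>s = 1 / t\<close>, the product rule gives the polynomial
  \<open>s\<^sup>2 * (p s - p' s)\<close>. At the origin the right difference quotient is again a
  polynomial in \<open>s\<close> times \<open>exp (- s)\<close>, and tends to zero.
\<close>

lemma flat_exp_has_derivative:
  "(flat_exp p has_real_derivative flat_exp ([:0, 0, 1:] * (p - pderiv p)) t) (at t)"
proof -
  consider "t < 0" | "t > 0" | "t = 0" by linarith
  then show ?thesis
  proof cases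
    case 1
    have "((\<lambda>t. 0) has_real_derivative 0) (at t)" by simp
    then have "(flat_exp p has_real_derivative 0) (at t)"
      by (rule has_field_derivative_transform_within_open[of _ _ _ "{..<0}"])
         (use 1 in \<open>auto simp: flat_exp_def\<close>)
    with 1 show ?thesis by (simp add: flat_exp_def)
  next
    case 2
    have "((\<lambda>t. poly p (1 / t)) has_real_derivative poly (pderiv p) (1 / t) * (- (1 / t\<^sup>2))) (at t)"
      by (rule DERIV_chain2[OF poly_DERIV])
         (use 2 in \<open>auto intro!: derivative_eq_intros simp: power2_eq_square\<close>)
    moreover have "((\<lambda>t. exp (- (1 / t))) has_real_derivative exp (- (1 / t)) * (1 / t\<^sup>2)) (at t)"
      by (rule DERIV_chain2[OF DERIV_exp])
         (use 2 in \<open>auto intro!: derivative_eq_intros simp: power2_eq_square\<close>)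
    ultimately have "((\<lambda>t. poly p (1 / t) * exp (- (1 / t))) has_real_derivative
        poly ([:0, 0, 1:] * (p - pderiv p)) (1 / t) * exp (- (1 / t))) (at t)"
      by (rule DERIV_mult[THEN DERIV_cong]) (simp add: algebra_simps power2_eq_square)
    then have "(flat_exp p has_real_derivative
        poly ([:0, 0, 1:] * (p - pderiv p)) (1 / t) * exp (- (1 / t))) (at t)"
      by (rule has_field_derivative_transform_within_open[of _ _ _ "{0<..}"])
         (use 2 in \<open>auto simp: flat_exp_def\<close>)
    with 2 show ?thesis by (simp add: flat_exp_def)
  next
    case 3
    have "((\<lambda>t. flat_exp p t / t) \<longlongrightarrow> 0) (at_left 0)"
      by (rule tendsto_eventually) (auto simp: flat_exp_def eventually_at_left_field intro!: exI[of _ "-1"])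
    moreover have "((\<lambda>t. flat_exp p t / t) \<longlongrightarrow> 0) (at_right 0)"
    proof -
      have "((\<lambda>t. poly ([:0,1:] * p) (inverse t) * exp (- inverse t)) \<longlongrightarrow> 0) (at_right (0::real))"
        by (rule filterlim_compose[OF poly_exp_tendsto_0 filterlim_inverse_at_top_right])
      then show ?thesis
        by (rule Lim_transform_eventually)
           (auto simp: flat_exp_def eventually_at_right_field field_simps intro!: exI[of _ 1])
    qed
    ultimately have "((\<lambda>t. flat_exp p t / t) \<longlongrightarrow> 0) (at 0)"
      by (simp add: filterlim_split_at)
    with 3 show ?thesis by (simp add: DERIV_def flat_exp_def)
  qed
qed

lemma times_differentiable_flat_exp: "times_differentiable n (flat_exp p)"
  by (induction n arbitrary: p) (auto intro: flat_exp_has_derivative)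

definition smooth_step :: "real \<Rightarrow> real" where
  "smooth_step t = flat_exp 1 t * inverse (flat_exp 1 t + flat_exp 1 (1 - t))"

lemma flat_exp_one: "flat_exp 1 t \<ge> 0" "flat_exp 1 t = 0 \<longleftrightarrow> t \<le> 0"
  by (auto simp: flat_exp_def)

lemma smooth_step_denominator: "flat_exp 1 t + flat_exp 1 (1 - t) > 0"
  using flat_exp_one[of t] flat_exp_one[of "1 - t"] by linarith

lemma smooth_step:
  "smooth_step t \<ge> 0"
  "t \<le> 0 \<Longrightarrow> smooth_step t = 0" "t \<ge> 1 \<Longrightarrow> smooth_step t = 1"
  using smooth_step_denominator[of t] flat_exp_one[of t] flat_exp_one[of "1 - t"]
  by (auto simp: smooth_step_def field_simps)

lemma times_differentiable_smooth_step: "times_differentiable n smooth_step"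
proof -
  have "times_differentiable n (\<lambda>t. flat_exp 1 (1 - t))"
    using times_differentiable_affine[OF times_differentiable_flat_exp, of n 1 "-1" 1] by simp
  then have "times_differentiable n (\<lambda>t. flat_exp 1 t * inverse (flat_exp 1 t + flat_exp 1 (1 - t)))"
    using smooth_step_denominator
    by (intro times_differentiable_mult times_differentiable_inverse times_differentiable_add
        times_differentiable_flat_exp) (simp_all add: less_imp_neq[symmetric])
  then show ?thesis by (simp add: smooth_step_def[abs_def])
qed

definition line_bump :: "real \<Rightarrow> real" where
  "line_bump t = smooth_step (t + 4) * smooth_step (4 - t)"

text \<open>
  The plateau has radius 3 and the support radius 4. The proof that the gradients of bumps of
  different sizes have disjoint supports needs the ratio of the two to be less than 2, with room
  to spare for the distance between neighbouring centres.
\<close>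

lemma line_bump:
  "line_bump t \<ge> 0"
  "\<bar>t\<bar> \<le> 3 \<Longrightarrow> line_bump t = 1" "\<bar>t\<bar> \<ge> 4 \<Longrightarrow> line_bump t = 0"
  using smooth_step[of "t + 4"] smooth_step[of "4 - t"]
  by (auto simp: line_bump_def abs_if split: if_splits)

lemma times_differentiable_line_bump: "times_differentiable n line_bump"
proof -
  have "times_differentiable n (\<lambda>t. smooth_step (1 * t + 4) * smooth_step ((-1) * t + 4))"
    by (intro times_differentiable_mult times_differentiable_affine times_differentiable_smooth_step)
  then show ?thesis by (simp add: line_bump_def[abs_def])
qed

text \<open>
  A sequence of successive derivatives is the form in which smoothness enters the plane: all
  iterated partial derivatives of a product of two bumps are products of members of this sequence.
\<close>

lemma line_bump_derivatives:
  obtains B where "B 0 = line_bump" "\<And>k x. (B k has_real_derivative B (Suc k) x) (at x)"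
proof
  define B where "B = (\<lambda>k. (deriv ^^ k) line_bump)"
  show "B 0 = line_bump" by (simp add: B_def)
  have "times_differentiable n (B k)" for n k
  proof (induction k arbitrary: n)
    case (Suc k)
    then obtain f' where f: "\<And>x. (B k has_real_derivative f' x) (at x)" "times_differentiable n f'"
      by (meson times_differentiable.simps(2))
    then have "f' x = B (Suc k) x" for x
      using DERIV_imp_deriv[OF f(1), of x] by (simp add: B_def)
    then have "f' = B (Suc k)" by blast
    with f show ?case by simp
  qed (simp add: B_def times_differentiable_line_bump)
  from this[of "Suc 0"] show "(B k has_real_derivative B (Suc k) x) (at x)" for k x
    by (simp add: B_def) (metis DERIV_imp_deriv)
qed

section \<open>Test functions on the plane\<close>

lemma partials_Nil [simp]: "partials [] f = f"
  by (simp add: partials_def)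

lemma partials_Cons [simp]: "partials (i # is) f = partial i (partials is f)"
  by (simp add: partials_def)

lemma has_derivative_partial:
  fixes f :: "real^2 \<Rightarrow> real"
  assumes "(f has_derivative f') (at x)"
  shows "partial i f x = f' (axis i 1)"
  using frechet_derivative_at[OF assms] by (simp add: partial_def)

lemma partial_affine:
  fixes f :: "real^2 \<Rightarrow> real"
  assumes "f differentiable at (c *\<^sub>R (x - z))"
  shows "(\<lambda>x. f (c *\<^sub>R (x - z))) differentiable at x"
    and "partial i (\<lambda>x. f (c *\<^sub>R (x - z))) x = c * partial i f (c *\<^sub>R (x - z))"
proof -
  obtain f' where f': "(f has_derivative f') (at (c *\<^sub>R (x - z)))"
    using assms by (auto simp: differentiable_def)
  have d: "((\<lambda>x. f (c *\<^sub>R (x - z))) has_derivative (\<lambda>h. f' (c *\<^sub>R h))) (at x)"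
    by (rule has_derivative_compose[where f = "\<lambda>x. c *\<^sub>R (x - z)", OF _ f'])
       (auto intro!: derivative_eq_intros)
  then show "(\<lambda>x. f (c *\<^sub>R (x - z))) differentiable at x"
    and "partial i (\<lambda>x. f (c *\<^sub>R (x - z))) x = c * partial i f (c *\<^sub>R (x - z))"
    using linear_scale[OF has_derivative_linear[OF f'], of c]
    by (auto simp: differentiable_def has_derivative_partial[OF f'] has_derivative_partial[OF d])
qed

lemma partial_cmult:
  assumes "f differentiable at x"
  shows "partial i (\<lambda>x. c * f x) x = c * partial i f x"
proof -
  obtain f' where f': "(f has_derivative f') (at x)"
    using assms by (auto simp: differentiable_def)
  then have "((\<lambda>x. c * f x) has_derivative (\<lambda>h. c * f' h)) (at x)"
    by (rule has_derivative_mult_right)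
  from has_derivative_partial[OF this] has_derivative_partial[OF f'] show ?thesis by simp
qed

lemma partial_sum:
  assumes "finite I" "\<And>j. j \<in> I \<Longrightarrow> f j differentiable at x"
  shows "partial i (\<lambda>x. \<Sum>j\<in>I. f j x) x = (\<Sum>j\<in>I. partial i (f j) x)"
proof -
  have "\<forall>j\<in>I. \<exists>f'. (f j has_derivative f') (at x)"
    using assms by (auto simp: differentiable_def)
  then obtain f' where f': "\<And>j. j \<in> I \<Longrightarrow> (f j has_derivative f' j) (at x)"
    by metis
  then have "((\<lambda>x. \<Sum>j\<in>I. f j x) has_derivative (\<lambda>h. \<Sum>j\<in>I. f' j h)) (at x)"
    by (rule has_derivative_sum)
  from has_derivative_partial[OF this] show ?thesis
    by (simp add: has_derivative_partial[OF f'])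
qed

lemma partial_mult:
  assumes "f differentiable at x" "g differentiable at x"
  shows "partial i (\<lambda>x. f x * g x) x = partial i f x * g x + f x * partial i g x"
proof -
  obtain f' g' where f': "(f has_derivative f') (at x)" and g': "(g has_derivative g') (at x)"
    using assms by (auto simp: differentiable_def)
  have "((\<lambda>x. f x * g x) has_derivative (\<lambda>h. f x * g' h + f' h * g x)) (at x)"
    by (rule has_derivative_mult[OF f' g'])
  from has_derivative_partial[OF this] show ?thesis
    by (simp add: has_derivative_partial[OF f'] has_derivative_partial[OF g'])
qed

lemma partials_affine:
  assumes "\<And>is x. partials is f differentiable at x"
  shows "partials is (\<lambda>x. f (c *\<^sub>R (x - z))) = (\<lambda>x. c ^ length is * partials is f (c *\<^sub>R (x - z)))"
proof (induction "is")
  case (Cons i "is")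
  have "partials (i # is) (\<lambda>x. f (c *\<^sub>R (x - z))) x
      = c ^ length (i # is) * partials (i # is) f (c *\<^sub>R (x - z))" for x
    using partial_affine[OF assms] by (simp add: Cons.IH partial_cmult)
  then show ?case by blast
qed simp

lemma partials_linear_combination:
  assumes "finite I" "\<And>j is x. j \<in> I \<Longrightarrow> partials is (f j) differentiable at x"
  shows "partials is (\<lambda>x. \<Sum>j\<in>I. a j * f j x) = (\<lambda>x. \<Sum>j\<in>I. a j * partials is (f j) x)"
proof (induction "is")
  case (Cons i "is")
  have "partials (i # is) (\<lambda>x. \<Sum>j\<in>I. a j * f j x) x = (\<Sum>j\<in>I. a j * partials (i # is) (f j) x)" for x
    using assms by (simp add: Cons.IH partial_sum partial_cmult)
  then show ?case by blast
qed simp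

lemma test_function_differentiable:
  "f \<in> test_functions \<Longrightarrow> partials is f differentiable at x"
  "f \<in> test_functions \<Longrightarrow> f differentiable at x"
  by (auto simp: test_functions_def dest: spec[of _ "[]"])

text \<open>
  A bound on the points where the function is nonzero is easier to supply than compactness of the
  closure of this set.
\<close>

lemma test_functionsI:
  assumes "\<And>is x. partials is f differentiable at x" "\<And>x. f x \<noteq> 0 \<Longrightarrow> norm x \<le> R"
  shows "f \<in> test_functions"
  using assms by (auto simp: test_functions_def compact_closure bounded_iff intro!: exI[of _ R])

lemma test_function_support:
  assumes "f \<in> test_functions"
  obtains R where "\<And>x. norm x > R \<Longrightarrow> f x = 0"
proof -
  have "bounded {x. f x \<noteq> 0}"
    using assms by (auto simp: test_functions_def)
  then obtain R where "\<And>x. f x \<noteq> 0 \<Longrightarrow> norm x \<le> R"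
    by (auto simp: bounded_iff)
  then show ?thesis using that[of R] by fastforce
qed

lemma test_function_affine:
  assumes f: "f \<in> test_functions" and c: "c > 0"
  shows "(\<lambda>x. f (c *\<^sub>R (x - z))) \<in> test_functions"
proof -
  obtain R where R: "\<And>x. norm x > R \<Longrightarrow> f x = 0"
    using test_function_support[OF f] by metis
  show ?thesis
  proof (rule test_functionsI[where R = "R / c + norm z"])
    show "partials is (\<lambda>x. f (c *\<^sub>R (x - z))) differentiable at x" for "is" x
      using f
      by (subst partials_affine)
         (auto intro!: partial_affine(1) differentiable_mult test_function_differentiable(1))
    fix x assume "f (c *\<^sub>R (x - z)) \<noteq> 0"
    then have "norm (c *\<^sub>R (x - z)) \<le> R" using R by force
    then have "norm (x - z) \<le> R / c"
      unfolding norm_scaleR using c by (simp add: pos_le_divide_eq mult.commute)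
    then show "norm x \<le> R / c + norm z"
      using norm_triangle_sub[of x z] by simp
  qed
qed

lemma test_function_linear_combination:
  assumes "finite I" "\<And>j. j \<in> I \<Longrightarrow> f j \<in> test_functions"
  shows "(\<lambda>x. \<Sum>j\<in>I. a j * f j x) \<in> test_functions"
proof -
  have "\<forall>j\<in>I. \<exists>R. \<forall>x. norm x > R \<longrightarrow> f j x = 0"
    using assms(2) by (meson test_function_support)
  then obtain R where R: "\<And>j x. j \<in> I \<Longrightarrow> norm x > R j \<Longrightarrow> f j x = 0"
    by metis
  show ?thesis
  proof (rule test_functionsI[where R = "\<Sum>j\<in>I. \<bar>R j\<bar>"])
    show "partials is (\<lambda>x. \<Sum>j\<in>I. a j * f j x) differentiable at x" for "is" x
      using assms
      by (subst partials_linear_combination)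
         (auto intro!: differentiable_sum differentiable_mult test_function_differentiable(1))
    fix x assume "(\<Sum>j\<in>I. a j * f j x) \<noteq> 0"
    then obtain j where j: "j \<in> I" "f j x \<noteq> 0"
      using sum.neutral[of I "\<lambda>j. a j * f j x"] by auto
    then have "norm x \<le> R j" using R[of j x] by fastforce
    also have "\<dots> \<le> (\<Sum>j\<in>I. \<bar>R j\<bar>)"
      using member_le_sum[of j I "\<lambda>j. \<bar>R j\<bar>"] j assms(1) by force
    finally show "norm x \<le> (\<Sum>j\<in>I. \<bar>R j\<bar>)" .
  qed
qed

definition plane_bump :: "real^2 \<Rightarrow> real" where
  "plane_bump x = line_bump (x $ 1) * line_bump (x $ 2)"

lemma plane_bump:
  "plane_bump x \<ge> 0"
  "(\<And>i. \<bar>x $ i\<bar> \<le> 3) \<Longrightarrow> plane_bump x = 1"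
  "\<bar>x $ i\<bar> \<ge> 4 \<Longrightarrow> plane_bump x = 0"
  using exhaust_2[of i] line_bump by (auto simp: plane_bump_def)

lemma has_derivative_product_of_coordinates:
  fixes x :: "real^2"
  assumes "(F has_real_derivative F') (at (x $ 1))" "(G has_real_derivative G') (at (x $ 2))"
  shows "((\<lambda>x. F (x $ 1) * G (x $ 2)) has_derivative
           (\<lambda>h. F (x $ 1) * (G' * h $ 2) + F' * h $ 1 * G (x $ 2))) (at x)"
proof -
  have "((\<lambda>x. F (x $ 1)) has_derivative (\<lambda>h. F' * h $ 1)) (at x)"
    by (rule has_derivative_compose[where f = "\<lambda>x. x $ 1", OF _ assms(1)[THEN has_field_derivative_imp_has_derivative]])
       (rule bounded_linear_imp_has_derivative[OF bounded_linear_vec_nth])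
  moreover have "((\<lambda>x. G (x $ 2)) has_derivative (\<lambda>h. G' * h $ 2)) (at x)"
    by (rule has_derivative_compose[where f = "\<lambda>x. x $ 2", OF _ assms(2)[THEN has_field_derivative_imp_has_derivative]])
       (rule bounded_linear_imp_has_derivative[OF bounded_linear_vec_nth])
  ultimately show ?thesis
    by (rule has_derivative_mult)
qed

lemma plane_bump_test_function: "plane_bump \<in> test_functions"
proof (rule test_functionsI[where R = 8])
  obtain B where B: "B 0 = line_bump" "\<And>k x. (B k has_real_derivative B (Suc k) x) (at x)"
    using line_bump_derivatives by metis
  have *: "((\<lambda>x. B j (x $ 1) * B k (x $ 2)) has_derivative
      (\<lambda>h. B j (x $ 1) * (B (Suc k) (x $ 2) * h $ 2) + B (Suc j) (x $ 1) * h $ 1 * B k (x $ 2))) (at x)"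
    for j k and x :: "real^2"
    by (intro has_derivative_product_of_coordinates B)
  have shape: "\<exists>j k. partials is plane_bump = (\<lambda>x. B j (x $ 1) * B k (x $ 2))" for "is"
  proof (induction "is")
    case Nil
    then show ?case by (auto simp: plane_bump_def fun_eq_iff B(1) intro!: exI[of _ 0])
  next
    case (Cons i "is")
    then obtain j k where jk: "partials is plane_bump = (\<lambda>x. B j (x $ 1) * B k (x $ 2))" by blast
    have "partials (1 # is) plane_bump = (\<lambda>x. B (Suc j) (x $ 1) * B k (x $ 2))"
      "partials (2 # is) plane_bump = (\<lambda>x. B j (x $ 1) * B (Suc k) (x $ 2))"
      by (simp_all add: jk has_derivative_partial[OF *] axis_def fun_eq_iff)
    then show ?case using exhaust_2[of i] by metis
  qed
  show "partials is plane_bump differentiable at x" for "is" x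
  proof -
    obtain j k where "partials is plane_bump = (\<lambda>x. B j (x $ 1) * B k (x $ 2))"
      using shape by blast
    then show ?thesis by (simp only: differentiableI[OF *])
  qed
  fix x assume "plane_bump x \<noteq> 0"
  then have "\<bar>x $ i\<bar> \<le> 4" for i
    using plane_bump(3)[of x i] by linarith
  then have "(\<Sum>i\<in>UNIV. \<bar>x $ i\<bar>) \<le> of_nat CARD(2) * 4"
    by (intro sum_bounded_above)
  then show "norm x \<le> 8"
    using norm_le_l1_cart[of x] by simp
qed

lemma partial_locally_constant:
  assumes "open S" "x \<in> S" "\<And>y. y \<in> S \<Longrightarrow> f y = c"
  shows "partial i f x = 0"
proof -
  have "((\<lambda>y. c) has_derivative (\<lambda>h. 0)) (at x)" by simp
  then have "(f has_derivative (\<lambda>h. 0)) (at x)"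
    by (rule has_derivative_transform_within_open) (use assms in auto)
  from has_derivative_partial[OF this] show ?thesis .
qed

text \<open>
  The gradient lives on a square annulus, because the bump is constant on the open square inside
  and on the open set outside.
\<close>

lemma partial_plane_bump_support:
  assumes "partial i plane_bump x \<noteq> 0"
  shows "\<bar>x $ j\<bar> \<le> 4" "\<exists>j. \<bar>x $ j\<bar> \<ge> 3"
proof -
  show "\<bar>x $ j\<bar> \<le> 4"
  proof (rule ccontr)
    assume "\<not> \<bar>x $ j\<bar> \<le> 4"
    then have "partial i plane_bump x = 0"
      by (intro partial_locally_constant[of "{x. \<bar>x $ j\<bar> > 4}" _ _ 0] open_Collect_less
          continuous_intros) (auto intro!: plane_bump(3)[where i = j])
    with assms show False by simp
  qed
  show "\<exists>j. \<bar>x $ j\<bar> \<ge> 3"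
  proof (rule ccontr)
    assume "\<not> (\<exists>j. \<bar>x $ j\<bar> \<ge> 3)"
    moreover have "{x::real^2. \<forall>j. \<bar>x $ j\<bar> < 3} = {x. \<bar>x $ 1\<bar> < 3} \<inter> {x. \<bar>x $ 2\<bar> < 3}"
      by (auto simp: forall_2)
    then have "open {x::real^2. \<forall>j. \<bar>x $ j\<bar> < 3}"
      by (auto intro!: open_Int open_Collect_less continuous_intros)
    ultimately have "partial i plane_bump x = 0"
      by (intro partial_locally_constant[of "{x. \<forall>j. \<bar>x $ j\<bar> < 3}" _ _ 1])
         (auto simp: not_le intro!: plane_bump(2) less_imp_le)
    with assms show False by simp
  qed
qed

section \<open>Classical gradients are weak gradients\<close>

lemma integrable_compact_support:
  fixes f :: "real^2 \<Rightarrow> real"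
  assumes "continuous_on UNIV f" "\<And>x. norm x > R \<Longrightarrow> f x = 0"
  shows "integrable lborel f"
proof -
  have "integrable lborel (\<lambda>x. indicator (cball 0 R) x *\<^sub>R f x)"
    using assms by (intro borel_integrable_compact) (auto intro: continuous_on_subset)
  moreover have "(\<lambda>x. indicator (cball 0 R) x *\<^sub>R f x) = f"
    using assms(2) by (auto simp: indicator_def fun_eq_iff)
  ultimately show ?thesis by simp
qed

lemma integral_lborel_translate:
  fixes f :: "real^2 \<Rightarrow> real"
  assumes "f \<in> borel_measurable borel"
  shows "(\<integral>x. f (z + x) \<partial>lborel) = (\<integral>x. f x \<partial>lborel)"
  using integral_distr[of "(+) z" lborel borel f] assms by (simp add: lborel_distr_plus)

text \<open>
  The plane has dimension two, so a dilation by \<open>c\<close> divides integrals by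
  \<open>c\<^sup>2\<close>. The square of a gradient is multiplied by \<open>c\<^sup>2\<close> at the
  same time, and hence the Dirichlet energy of a bump does not depend on its size. This is the
  scale invariance on which the construction rests.
\<close>

lemma integral_lborel_rescale:
  fixes f :: "real^2 \<Rightarrow> real"
  assumes [measurable]: "f \<in> borel_measurable borel" and c: "c > 0"
  shows "(\<integral>x. f (c *\<^sub>R (x - z)) \<partial>lborel) = (\<integral>x. f x \<partial>lborel) / c\<^sup>2"
proof -
  have "(\<integral>x. f x \<partial>lborel) = (\<integral>x. f x \<partial>density (distr lborel borel (\<lambda>x. - (c *\<^sub>R z) + c *\<^sub>R x)) (\<lambda>_. ennreal (\<bar>c\<bar> ^ DIM(real^2))))"
    using lborel_affine[of c "- (c *\<^sub>R z)"] c by simp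
  also have "\<dots> = (\<integral>x. c\<^sup>2 * f (- (c *\<^sub>R z) + c *\<^sub>R x) \<partial>lborel)"
    using c by (subst integral_density) (auto simp: integral_distr)
  also have "\<dots> = c\<^sup>2 * (\<integral>x. f (c *\<^sub>R (x - z)) \<partial>lborel)"
    by (simp add: algebra_simps)
  finally show ?thesis using c by simp
qed

lemma continuous_partial:
  "f \<in> test_functions \<Longrightarrow> continuous_on UNIV (partial i f)"
  using continuous_partials[of f "[i]"] by simp

lemma partial_eq_0_outside:
  assumes "\<And>x. norm x > R \<Longrightarrow> f x = 0" "norm x > R"
  shows "partial i f x = 0"
  using assms
  by (intro partial_locally_constant[of "{x. norm x > R}" _ _ 0] open_Collect_less continuous_intros)
     auto

lemma partial_mean_value:
  fixes f :: "real^2 \<Rightarrow> real"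
  assumes "\<And>x. f differentiable at x" "h > 0"
  shows "\<exists>\<xi>. 0 < \<xi> \<and> \<xi> < h \<and> f (h *\<^sub>R axis i 1 + x) - f x = h * partial i f (\<xi> *\<^sub>R axis i 1 + x)"
proof -
  have "((\<lambda>t. f (t *\<^sub>R axis i 1 + x)) has_real_derivative partial i f (t *\<^sub>R axis i 1 + x)) (at t)" for t
  proof -
    obtain f' where f': "(f has_derivative f') (at (t *\<^sub>R axis i 1 + x))"
      using assms(1) by (auto simp: differentiable_def)
    have "((\<lambda>t. f (t *\<^sub>R axis i 1 + x)) has_derivative (\<lambda>h. f' (h *\<^sub>R axis i 1))) (at t)"
      by (rule has_derivative_compose[where f = "\<lambda>t. t *\<^sub>R axis i 1 + x", OF _ f'])
         (auto intro!: derivative_eq_intros)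
    moreover have "f' (h *\<^sub>R axis i 1) = partial i f (t *\<^sub>R axis i 1 + x) * h" for h
      unfolding has_derivative_partial[OF f']
      by (subst linear_scale[OF has_derivative_linear[OF f']]) simp
    ultimately show ?thesis
      by (simp add: has_field_derivative_def)
  qed
  from MVT2[OF \<open>h > 0\<close> this] show ?thesis by auto
qed

text \<open>
  Difference quotients in the direction of the derivative have integral zero by translation
  invariance. The mean value theorem dominates them by a multiple of the indicator of a ball, and
  they converge to the partial derivative.
\<close>

lemma integral_partial_eq_0:
  fixes f :: "real^2 \<Rightarrow> real"
  assumes f: "\<And>x. f differentiable at x" and cont: "continuous_on UNIV (partial i f)"
    and supp: "\<And>x. norm x > R \<Longrightarrow> f x = 0"
  shows "(\<integral>x. partial i f x \<partial>lborel) = 0"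
proof -
  let ?e = "axis i 1 :: real^2"
  let ?h = "\<lambda>m. inverse (real (Suc m))"
  define q where "q m x = (f (?h m *\<^sub>R ?e + x) - f x) / ?h m" for m x
  have f_cont: "continuous_on UNIV f"
    using f by (auto simp: continuous_on_eq_continuous_within intro: differentiable_imp_continuous_within)
  have [measurable]: "f \<in> borel_measurable borel" "partial i f \<in> borel_measurable borel"
    using f_cont cont by (auto intro: borel_measurable_continuous_onI)
  have "\<exists>\<xi>. 0 < \<xi> \<and> \<xi> < ?h m \<and> q m x = partial i f (\<xi> *\<^sub>R ?e + x)" for m x
    using partial_mean_value[OF f, of "?h m" i x] by (force simp: q_def)
  then obtain \<xi> where \<xi>: "\<And>m x. 0 < \<xi> m x" "\<And>m x. \<xi> m x < ?h m"
      "\<And>m x. q m x = partial i f (\<xi> m x *\<^sub>R ?e + x)"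
    by metis
  have h_le: "?h m \<le> 1" for m by (simp add: field_simps)
  have "compact (partial i f ` cball 0 R)"
    using cont by (intro compact_continuous_image) (auto intro: continuous_on_subset)
  then obtain M where M: "\<And>x. norm x \<le> R \<Longrightarrow> \<bar>partial i f x\<bar> \<le> M"
    by (fastforce dest: compact_imp_bounded simp: bounded_iff)
  have bound: "norm (q m x) \<le> \<bar>M\<bar> * indicator (cball 0 (R + 1)) x" for m x
  proof -
    have "norm x \<le> norm (\<xi> m x *\<^sub>R ?e + x) + norm (\<xi> m x *\<^sub>R ?e)"
      by (metis add.commute add_diff_cancel_left' norm_triangle_ineq4 norm_minus_commute)
    also have "norm (\<xi> m x *\<^sub>R ?e) \<le> 1"
      using \<xi>(1,2)[of m x] h_le[of m] by simp
    finally have "norm (\<xi> m x *\<^sub>R ?e + x) > R" if "norm x > R + 1"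
      using that by simp
    then show ?thesis
      using M[of "\<xi> m x *\<^sub>R ?e + x"] partial_eq_0_outside[OF supp]
      by (cases "norm (\<xi> m x *\<^sub>R ?e + x) > R") (auto simp: \<xi>(3) indicator_def)
  qed
  have lim: "(\<lambda>m. q m x) \<longlonglongrightarrow> partial i f x" for x
  proof -
    have "(\<lambda>m. \<xi> m x) \<longlonglongrightarrow> 0"
      by (rule tendsto_sandwich[OF _ _ tendsto_const LIMSEQ_inverse_real_of_nat])
         (simp_all add: less_imp_le[OF \<xi>(1)] less_imp_le[OF \<xi>(2)] del: of_nat_Suc)
    then have "(\<lambda>m. \<xi> m x *\<^sub>R ?e + x) \<longlonglongrightarrow> 0 *\<^sub>R ?e + x"
      by (intro tendsto_intros)
    then have "(\<lambda>m. partial i f (\<xi> m x *\<^sub>R ?e + x)) \<longlonglongrightarrow> partial i f (0 *\<^sub>R ?e + x)"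
      by (rule continuous_on_tendsto_compose[OF cont]) simp_all
    then show ?thesis by (simp add: \<xi>(3))
  qed
  have "(\<lambda>m. \<integral>x. q m x \<partial>lborel) \<longlonglongrightarrow> (\<integral>x. partial i f x \<partial>lborel)"
  proof (rule integral_dominated_convergence)
    show "integrable lborel (\<lambda>x::real^2. \<bar>M\<bar> * indicator (cball 0 (R + 1)) x :: real)"
      by (intro integrable_mult_right integrable_real_indicator)
         (use emeasure_bounded_finite[OF bounded_cball, of "0 :: real^2" "R + 1"] in auto)
    show "q m \<in> borel_measurable lborel" for m
      unfolding q_def by measurable
  qed (use lim bound in auto)
  moreover have "(\<integral>x. q m x \<partial>lborel) = 0" for m
  proof -
    have "integrable lborel f"
      using f_cont supp by (rule integrable_compact_support)
    moreover have "integrable lborel (\<lambda>x. f (?h m *\<^sub>R ?e + x))"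
    proof (rule integrable_compact_support)
      show "continuous_on UNIV (\<lambda>x. f (?h m *\<^sub>R ?e + x))"
        by (rule continuous_on_compose2[OF f_cont]) (auto intro!: continuous_intros)
      fix x :: "real^2" assume x: "norm x > R + 1"
      have "norm x \<le> norm (?h m *\<^sub>R ?e + x) + norm (?h m *\<^sub>R ?e)"
        by (metis add.commute add_diff_cancel_left' norm_triangle_ineq4 norm_minus_commute)
      moreover have "norm (?h m *\<^sub>R ?e) \<le> 1" using h_le[of m] by simp
      ultimately show "f (?h m *\<^sub>R ?e + x) = 0"
        using x by (intro supp) linarith
    qed
    ultimately show ?thesis
      by (simp add: q_def integral_lborel_translate)
  qed
  ultimately show ?thesis
    by (simp add: LIMSEQ_const_iff)
qed

lemma test_functions_cases:
  assumes "u \<in> test_functions"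
  obtains R where "\<And>x. norm x > R \<Longrightarrow> u x = 0" "\<And>i x. norm x > R \<Longrightarrow> partial i u x = 0"
  using test_function_support[OF assms] partial_eq_0_outside by metis

text \<open>
  Integration by parts: the partial derivative of the product with a test function integrates to
  zero.
\<close>

lemma weak_gradient_test_function:
  assumes u: "u \<in> test_functions"
  shows "weak_gradient u (\<lambda>x. \<chi> i. partial i u x)"
  unfolding weak_gradient_def
proof (intro ballI allI)
  fix \<phi> i assume \<phi>: "\<phi> \<in> test_functions"
  obtain R where R: "\<And>x. norm x > R \<Longrightarrow> u x = 0" "\<And>i x. norm x > R \<Longrightarrow> partial i u x = 0"
    using test_functions_cases[OF u] by metis
  note cont = continuous_test_function[OF u] continuous_test_function[OF \<phi>]
    continuous_partial[OF u] continuous_partial[OF \<phi>]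
  have prod: "partial i (\<lambda>x. u x * \<phi> x) = (\<lambda>x. partial i u x * \<phi> x + u x * partial i \<phi> x)"
    using u \<phi> by (auto intro!: partial_mult test_function_differentiable)
  have "(\<integral>x. partial i (\<lambda>x. u x * \<phi> x) x \<partial>lborel) = 0"
    using R u \<phi> by (intro integral_partial_eq_0[of _ _ R])
      (auto simp: prod intro!: continuous_intros cont differentiable_mult
        test_function_differentiable(2)[OF u] test_function_differentiable(2)[OF \<phi>])
  moreover have "integrable lborel (\<lambda>x. partial i u x * \<phi> x)"
    using R by (intro integrable_compact_support[of _ R] continuous_intros cont) auto
  moreover have "integrable lborel (\<lambda>x. u x * partial i \<phi> x)"
    using R by (intro integrable_compact_support[of _ R] continuous_intros cont) auto
  ultimately show "(\<integral>x. u x * partial i \<phi> x \<partial>lborel) = - (\<integral>x. (\<chi> i. partial i u x) $ i * \<phi> x \<partial>lborel)"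
    by (simp add: prod)
qed

lemma power2_norm_vec: "(norm (x :: real^2))\<^sup>2 = (\<Sum>i\<in>UNIV. (x $ i)\<^sup>2)"
  by (simp add: power2_norm_eq_inner inner_vec_def power2_eq_square[of "_ $ _"])

lemma test_function_integrable_square:
  assumes "u \<in> test_functions"
  shows "integrable lborel (\<lambda>x. (u x)\<^sup>2)" "integrable lborel (\<lambda>x. (partial i u x)\<^sup>2)"
proof -
  obtain R where R: "\<And>x. norm x > R \<Longrightarrow> u x = 0" "\<And>i x. norm x > R \<Longrightarrow> partial i u x = 0"
    using test_functions_cases[OF assms] by metis
  then show "integrable lborel (\<lambda>x. (u x)\<^sup>2)" "integrable lborel (\<lambda>x. (partial i u x)\<^sup>2)"
    using assms
    by (auto intro!: integrable_compact_support[of _ R] continuous_intros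
        continuous_test_function[OF assms] continuous_partial[OF assms])
qed

lemma test_function_in_H1:
  assumes u: "u \<in> test_functions"
  shows "u \<in> H1" "(\<lambda>x. \<chi> i. partial i u x) \<in> L2"
proof -
  have "continuous_on UNIV (\<lambda>x. \<chi> i. partial i u x)"
    by (intro continuous_intros continuous_partial u)
  then show *: "(\<lambda>x. \<chi> i. partial i u x) \<in> L2"
    using test_function_integrable_square[OF u]
    by (auto simp: L2_def power2_norm_vec intro!: borel_measurable_continuous_onI)
  show "u \<in> H1"
    using test_function_integrable_square(1)[OF u] * weak_gradient_test_function[OF u]
      continuous_test_function[OF u]
    by (auto simp: H1_def L2_def intro!: borel_measurable_continuous_onI)
qed

lemma H1_norm_test_function:
  assumes "u \<in> test_functions"
  shows "H1_norm u (\<lambda>x. \<chi> i. partial i u x)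
    = sqrt ((\<integral>x. (u x)\<^sup>2 \<partial>lborel) + (\<Sum>i\<in>UNIV. \<integral>x. (partial i u x)\<^sup>2 \<partial>lborel))"
  using test_function_integrable_square[OF assms]
  by (simp add: H1_norm_def power2_norm_vec)

text \<open>
  All that is needed of the dual space: on test functions its members are controlled by the
  classical Sobolev norm. To refute membership it suffices to exhibit test functions that violate
  such a bound.
\<close>

lemma H_minus1_bound:
  assumes "S \<in> H_minus1"
  obtains C where "\<And>u. u \<in> test_functions \<Longrightarrow> \<bar>S u\<bar> \<le> C *
    sqrt ((\<integral>x. (u x)\<^sup>2 \<partial>lborel) + (\<Sum>i\<in>UNIV. \<integral>x. (partial i u x)\<^sup>2 \<partial>lborel))"
proof -
  obtain L C where "\<And>u. u \<in> test_functions \<Longrightarrow> S u = L u"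
    "\<And>u g. u \<in> H1 \<Longrightarrow> g \<in> L2 \<Longrightarrow> weak_gradient u g \<Longrightarrow> \<bar>L u\<bar> \<le> C * H1_norm u g"
    using assms unfolding H_minus1_def H1_dual_def by blast
  then show ?thesis
    using that[of C] test_function_in_H1 weak_gradient_test_function
    by (metis H1_norm_test_function)
qed

section \<open>A Cantor set with doubly exponentially small gaps\<close>

text \<open>
  The digit of index \<open>n\<close> has weight \<open>gap n = 2 powr (- 16 * 2 ^ n)\<close>. After
  \<open>n\<close> digits there are \<open>2 ^ n\<close> pieces, each of mass \<open>2 powr (- n)\<close>
  and of diameter comparable to \<open>gap n\<close>, so that mass times logarithm of the diameter
  stays bounded, which is exactly the growth permitted by the log-Morrey condition. The factor 16
  leaves a range of \<open>2 ^ n\<close> dyadic scales well inside the interval between two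
  consecutive gaps.
\<close>

definition gap_exponent :: "nat \<Rightarrow> nat" where
  "gap_exponent n = 16 * 2 ^ n"

definition gap :: "nat \<Rightarrow> real" where
  "gap n = (1 / 2) ^ gap_exponent n"

lemma gap_pos: "gap n > 0"
  by (simp add: gap_def)

lemma gap_Suc: "gap (Suc n) \<le> gap n / 4"
proof -
  have "gap (Suc n) \<le> (1 / 2) ^ (gap_exponent n + 2)"
    unfolding gap_def by (intro power_decreasing) (auto simp: gap_exponent_def)
  then show ?thesis by (simp add: gap_def power_add)
qed

lemma gap_antimono: "m \<le> n \<Longrightarrow> gap n \<le> gap m"
  unfolding gap_def by (intro power_decreasing) (auto simp: gap_exponent_def)

lemma gap_add: "gap (n + k) \<le> gap n * (1 / 2) ^ k"
proof (induction k)
  case (Suc k)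
  then show ?case using gap_Suc[of "n + k"] gap_pos[of "n + k"] by simp
qed simp

lemma gap_tail: "summable (\<lambda>k. gap (n + k))" "(\<Sum>k. gap (n + k)) \<le> 2 * gap n"
proof -
  have s: "(\<lambda>k. gap n * (1 / 2) ^ k) sums (gap n * (1 / (1 - 1 / 2)))"
    by (intro sums_mult geometric_sums) simp
  show 1: "summable (\<lambda>k. gap (n + k))"
    using gap_add by (intro summable_comparison_test'[OF sums_summable[OF s], of 0])
      (simp add: less_imp_le[OF gap_pos])
  show "(\<Sum>k. gap (n + k)) \<le> 2 * gap n"
    using suminf_le[OF gap_add 1 sums_summable[OF s]] sums_unique[OF s] by simp
qed

lemma gap_tendsto_0: "gap \<longlonglongrightarrow> 0"
  using summable_LIMSEQ_zero[OF gap_tail(1)[of 0]] by simp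

definition cantor_coordinate :: "(nat \<Rightarrow> bool) \<Rightarrow> real" where
  "cantor_coordinate b = (\<Sum>j. of_bool (b j) * gap j)"

lemma of_bool_gap_le: "0 \<le> of_bool v * gap j" "of_bool v * gap j \<le> gap j"
  using gap_pos[of j] by (cases v; simp)+

lemma cantor_summable: "summable (\<lambda>j. of_bool (b j) * gap j)"
proof (rule summable_comparison_test'[where g = gap and N = 0])
  show "summable gap" using gap_tail(1)[of 0] by simp
  show "norm (of_bool (b n) * gap n) \<le> gap n" for n
    using of_bool_gap_le[of "b n" n] by simp
qed

lemma cantor_coordinate_split:
  "cantor_coordinate b = (\<Sum>j<n. of_bool (b j) * gap j) + (\<Sum>k. of_bool (b (n + k)) * gap (n + k))"
  unfolding cantor_coordinate_def
  using suminf_split_initial_segment[OF cantor_summable, of b n] by (simp add: add.commute)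

lemma cantor_tail:
  "0 \<le> (\<Sum>k. of_bool (b (n + k)) * gap (n + k))"
  "(\<Sum>k. of_bool (b (n + k)) * gap (n + k)) \<le> 2 * gap n"
proof -
  have s: "summable (\<lambda>k. of_bool (b (n + k)) * gap (n + k))"
    using cantor_summable[of b, THEN summable_ignore_initial_segment, of n] by (simp add: add.commute)
  show "0 \<le> (\<Sum>k. of_bool (b (n + k)) * gap (n + k))"
    by (intro suminf_nonneg s of_bool_gap_le)
  have "(\<Sum>k. of_bool (b (n + k)) * gap (n + k)) \<le> (\<Sum>k. gap (n + k))"
    by (intro suminf_le s gap_tail of_bool_gap_le)
  then show "(\<Sum>k. of_bool (b (n + k)) * gap (n + k)) \<le> 2 * gap n"
    using gap_tail(2)[of n] by simp
qed

lemma cantor_coordinate_close: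
  assumes "\<And>j. j < n \<Longrightarrow> b j = b' j"
  shows "\<bar>cantor_coordinate b - cantor_coordinate b'\<bar> \<le> 2 * gap n"
proof -
  have "(\<Sum>j<n. of_bool (b j) * gap j) = (\<Sum>j<n. of_bool (b' j) * gap j)"
    using assms by (intro sum.cong) auto
  then show ?thesis
    using cantor_tail[of b n] cantor_tail[of b' n]
    by (simp add: cantor_coordinate_split[of _ n])
qed

text \<open>
  At the first digit where the sequences differ, at some place \<open>m\<close>, the coordinates differ
  by \<open>gap m\<close> up to the tails, which amount to at most \<open>2 * gap (Suc m)\<close>, at most
  half of it.
\<close>

lemma cantor_coordinate_separated:
  assumes "b j \<noteq> b' j" "j < n"
  shows "\<bar>cantor_coordinate b - cantor_coordinate b'\<bar> \<ge> gap (n - 1) / 2"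
proof -
  define m where "m = (LEAST j. b j \<noteq> b' j)"
  have m: "b m \<noteq> b' m"
    unfolding m_def using assms(1) by (rule LeastI)
  have m_le: "m \<le> j"
    unfolding m_def using assms(1) by (rule Least_le)
  have before: "b i = b' i" if "i < m" for i
    using not_less_Least[OF that[unfolded m_def]] by simp
  have "(\<Sum>i<m. of_bool (b i) * gap i) = (\<Sum>i<m. of_bool (b' i) * gap i)"
    using before by (intro sum.cong) auto
  then have "\<bar>cantor_coordinate b - cantor_coordinate b'\<bar> \<ge> gap m - 2 * gap (Suc m)"
    using m cantor_tail[of b "Suc m"] cantor_tail[of b' "Suc m"]
    unfolding cantor_coordinate_split[of _ "Suc m"]
    by (cases "b m"; cases "b' m") auto
  moreover have "gap m \<ge> gap (n - 1)"
    using m_le assms(2) by (intro gap_antimono) auto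
  ultimately show ?thesis
    using gap_Suc[of m] by simp
qed

lemma inj_cantor_coordinate: "inj cantor_coordinate"
proof (rule injI, rule ccontr)
  fix b b' assume eq: "cantor_coordinate b = cantor_coordinate b'" and "b \<noteq> b'"
  then obtain j where "b j \<noteq> b' j" by blast
  from cantor_coordinate_separated[where b = b and b' = b' and n = "Suc j", OF this] eq gap_pos[of j] show False by simp
qed

lemma cantor_coordinate_range: "0 \<le> cantor_coordinate b" "cantor_coordinate b \<le> 1"
proof -
  have "gap 0 \<le> 1 / 2"
    using power_decreasing[of 1 16 "1 / 2 :: real"] by (simp add: gap_def gap_exponent_def)
  then show "0 \<le> cantor_coordinate b" "cantor_coordinate b \<le> 1"
    using cantor_tail[of b 0] by (simp_all add: cantor_coordinate_def)
qed

lemma continuous_digit: "continuous_on UNIV (\<lambda>b::nat \<Rightarrow> bool. of_bool (b j) :: real)"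
proof -
  have "continuous_on UNIV (of_bool :: bool \<Rightarrow> real)"
    unfolding continuous_on_open_vimage[OF open_UNIV]
    by (simp add: discrete_topology_class.open_discrete)
  then show ?thesis
    by (rule continuous_on_compose2[OF _ continuous_on_product_coordinates]) simp
qed

lemma continuous_cantor_coordinate: "continuous_on UNIV cantor_coordinate"
proof -
  have "uniform_limit UNIV (\<lambda>n b. \<Sum>j<n. of_bool (b j) * gap j) (\<lambda>b. \<Sum>j. of_bool (b j) * gap j) sequentially"
  proof (rule Weierstrass_m_test[where M = gap])
    show "summable gap" using gap_tail(1)[of 0] by simp
    show "norm (of_bool (b n) * gap n) \<le> gap n" for b :: "nat \<Rightarrow> bool" and n
      using of_bool_gap_le[of "b n" n] by simp
  qed
  moreover have "continuous_on UNIV (\<lambda>b. \<Sum>j<n. of_bool (b j) * gap j)" for n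
  proof (intro continuous_intros)
    fix j
    show "continuous_on UNIV (\<lambda>b::nat \<Rightarrow> bool. of_bool (b j) :: real)"
      by (rule continuous_digit)
  qed
  ultimately show ?thesis
    unfolding cantor_coordinate_def[abs_def]
    by (intro uniform_limit_theorem[where F = sequentially]) auto
qed

definition cantor_point :: "(nat \<Rightarrow> bool) \<Rightarrow> real^2" where
  "cantor_point b = cantor_coordinate b *\<^sub>R axis 1 1"

lemma cantor_point_nth: "cantor_point b $ i = (if i = 1 then cantor_coordinate b else 0)"
  by (simp add: cantor_point_def axis_def)

lemma dist_cantor_point:
  "dist (cantor_point b) (cantor_point b') = \<bar>cantor_coordinate b - cantor_coordinate b'\<bar>"
  by (simp add: cantor_point_def dist_norm flip: scaleR_diff_left)

lemma inj_cantor_point: "inj cantor_point"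
  using inj_cantor_coordinate by (auto simp: inj_def cantor_point_def)

lemma continuous_cantor_point: "continuous_on A cantor_point"
  unfolding cantor_point_def
  by (intro continuous_intros continuous_on_subset[OF continuous_cantor_coordinate]) auto

text \<open>
  Tychonoff's theorem, with the topology of pointwise convergence on functions.
\<close>

lemma compact_boolean_sequences: "compact (UNIV :: (nat \<Rightarrow> bool) set)"
proof -
  have "compact (UNIV :: bool set)"
    by (intro finite_imp_compact) simp
  then have "compact_space (product_topology (\<lambda>i::nat. euclidean :: bool topology) UNIV)"
    unfolding compact_space_product_topology by (simp add: compact_space_def)
  then show ?thesis
    by (simp add: euclidean_product_topology compact_space_def)
qed

text \<open>
  The parametrisation by digit sequences is a continuous injection of a compact space, hence its
  inverse is continuous, and so is every digit as a function on the set. On a connected subset each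
  digit is therefore constant. Flipping a late digit moves a point by a small nonzero amount, so no
  point is isolated.
\<close>

lemma cantor_set_range: "cantor_set (range cantor_point)"
  unfolding cantor_set_def
proof (intro conjI ballI allI impI)
  show "compact (range cantor_point)"
    by (intro compact_continuous_image continuous_cantor_point compact_boolean_sequences)
next
  fix x assume "x \<in> range cantor_point"
  then obtain b where x: "x = cantor_point b" by blast
  show "x islimpt range cantor_point"
    unfolding islimpt_approachable
  proof (intro allI impI)
    fix e :: real assume "e > 0"
    then have "\<forall>\<^sub>F n in sequentially. gap n < e / 2"
      by (intro order_tendstoD[OF gap_tendsto_0]) simp
    then obtain n where n: "gap n < e / 2"
      by (auto simp: eventually_sequentially)
    define b' where "b' = b(n := \<not> b n)"
    have "b' \<noteq> b" by (auto simp: b'_def fun_eq_iff)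
    moreover have "dist (cantor_point b') x \<le> 2 * gap n"
      unfolding x dist_cantor_point by (rule cantor_coordinate_close) (auto simp: b'_def)
    ultimately show "\<exists>x'\<in>range cantor_point. x' \<noteq> x \<and> dist x' x < e"
      using n inj_cantor_point by (intro bexI[of _ "cantor_point b'"]) (auto simp: x inj_eq)
  qed
next
  fix C assume C: "C \<subseteq> range cantor_point \<and> connected C"
  have inv: "inv cantor_point (cantor_point b) = b" for b
    using inj_cantor_point by (rule inv_f_f)
  then have "continuous_on (range cantor_point) (inv cantor_point)"
    by (intro continuous_on_inv continuous_cantor_point compact_boolean_sequences) simp
  then have cont_C: "continuous_on C (inv cantor_point)"
    using C by (auto intro: continuous_on_subset)
  have cont: "continuous_on C (\<lambda>x. of_bool (inv cantor_point x j) :: real)" for j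
    by (rule continuous_on_compose2[OF continuous_digit cont_C]) simp
  have const: "inv cantor_point x j = inv cantor_point y j" if "x \<in> C" "y \<in> C" for x y j
  proof -
    let ?d = "\<lambda>x. of_bool (inv cantor_point x j) :: real"
    have "connected (?d ` C)"
      using cont C by (intro connected_continuous_image) auto
    moreover have "finite (?d ` C)"
      by (rule finite_subset[of _ "{0, 1}"]) auto
    ultimately have "\<exists>v. ?d ` C = {v}"
      using connected_finite_iff_sing[of "?d ` C"] that by auto
    then obtain v where "?d ` C = {v}" by (elim exE)
    moreover have "?d x \<in> ?d ` C" "?d y \<in> ?d ` C" using that by simp_all
    ultimately have "?d x = ?d y" by simp
    then show ?thesis by (simp only: of_bool_eq_iff)
  qed
  have "x = y" if xy: "x \<in> C" "y \<in> C" for x y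
  proof -
    obtain b b' where "x = cantor_point b" "y = cantor_point b'" using xy C by blast
    moreover from this const[OF xy] have "b = b'" by (simp add: inv fun_eq_iff)
    ultimately show ?thesis by simp
  qed
  then show "\<exists>x. C \<subseteq> {x}" by blast
qed auto

lemma cantor_point_in_square: "cantor_point b \<in> cbox (vec 0) (vec 1)"
  using cantor_coordinate_range by (simp add: mem_box_cart cantor_point_nth)

text \<open>
  The measure is the distribution of the point whose digits are independent fair coin tosses.
\<close>

definition coin :: "bool measure" where
  "coin = uniform_count_measure UNIV"

definition coin_sequences :: "(nat \<Rightarrow> bool) measure" where
  "coin_sequences = PiM UNIV (\<lambda>_. coin)"

lemma coin_simps: "space coin = UNIV" "sets coin = UNIV" "emeasure coin {v} = ennreal (1 / 2)"
  by (auto simp: coin_def sets_uniform_count_measure emeasure_uniform_count_measure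
      space_uniform_count_measure)

lemma prob_space_coin: "prob_space coin"
  unfolding coin_def by (intro prob_space_uniform_count_measure) auto

lemma prob_space_coin_sequences: "prob_space coin_sequences"
  unfolding coin_sequences_def by (intro prob_space_PiM prob_space_coin)

text \<open>
  Measurability comes last, since a set of nonzero measure is measurable.
\<close>

lemma emeasure_cylinder:
  "emeasure coin_sequences {b. \<forall>j<n. b j = c j} = ennreal ((1 / 2) ^ n)"
  "{b. \<forall>j<n. b j = c j} \<in> sets coin_sequences"
proof -
  interpret product_prob_space "\<lambda>_::nat. coin" UNIV
    by (intro product_prob_spaceI prob_space_coin)
  have eq: "{b. \<forall>j<n. b j = c j} = {b \<in> space (PiM UNIV (\<lambda>_. coin)). \<forall>j\<in>{..<n}. b j \<in> {c j}}"
    by (auto simp: space_PiM coin_simps)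
  have "emeasure coin_sequences {b. \<forall>j<n. b j = c j} = (\<Prod>j\<in>{..<n}. emeasure coin {c j})"
    unfolding eq coin_sequences_def by (subst emeasure_PiM_Collect) (auto simp: coin_simps)
  also have "\<dots> = ennreal (1 / 2) ^ n"
    by (simp only: coin_simps prod_constant card_lessThan)
  also have "\<dots> = ennreal ((1 / 2) ^ n)"
    by (rule ennreal_power) simp
  finally show *: "emeasure coin_sequences {b. \<forall>j<n. b j = c j} = ennreal ((1 / 2) ^ n)" .
  show "{b. \<forall>j<n. b j = c j} \<in> sets coin_sequences"
    by (rule emeasure_neq_0_sets) (simp add: *)
qed

lemma measurable_cantor_point: "cantor_point \<in> borel_measurable coin_sequences"
proof -
  have "(\<lambda>b. b j) \<in> measurable coin_sequences coin" for j
    unfolding coin_sequences_def by (rule measurable_component_singleton) simp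
  moreover have "(of_bool :: bool \<Rightarrow> real) \<in> borel_measurable coin"
    by (auto simp: measurable_def coin_simps)
  ultimately have [measurable]: "(\<lambda>b. of_bool (b j) :: real) \<in> borel_measurable coin_sequences" for j
    by (rule measurable_compose)
  show ?thesis
    unfolding cantor_point_def cantor_coordinate_def by measurable
qed

definition cantor_measure :: "(real^2) measure" where
  "cantor_measure = distr coin_sequences borel cantor_point"

lemma prob_space_cantor_measure: "prob_space cantor_measure"
  unfolding cantor_measure_def
  by (intro prob_space.prob_space_distr prob_space_coin_sequences measurable_cantor_point)

lemma sets_cantor_measure: "sets cantor_measure = sets borel"
  by (simp add: cantor_measure_def)

lemma AE_cantor_measure: "AE x in cantor_measure. x \<in> range cantor_point"
proof -
  have "range cantor_point \<in> sets borel"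
    using cantor_set_range by (simp add: cantor_set_def borel_compact)
  then show ?thesis
    unfolding cantor_measure_def by (subst AE_distr_iff[OF measurable_cantor_point]) auto
qed

lemma measure_cantor_set: "measure cantor_measure (range cantor_point) = 1"
proof -
  interpret prob_space cantor_measure by (rule prob_space_cantor_measure)
  have "range cantor_point \<in> sets borel"
    using cantor_set_range by (simp add: cantor_set_def borel_compact)
  with AE_cantor_measure show ?thesis
    by (subst prob_eq_1) (auto simp: sets_cantor_measure)
qed

text \<open>
  Points closer than half of the gap \<open>n - 1\<close> share their first \<open>n\<close> digits, so
  the set lies in one cylinder. For \<open>n = 0\<close> the subtraction truncates, but then the bound
  is the trivial one for a probability measure.
\<close>

lemma cantor_measure_diameter:
  assumes A: "A \<in> sets borel" and d: "\<And>x y. x \<in> A \<Longrightarrow> y \<in> A \<Longrightarrow> \<bar>x $ 1 - y $ 1\<bar> < gap (n - 1) / 2"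
  shows "emeasure cantor_measure A \<le> ennreal ((1 / 2) ^ n)"
proof (cases "cantor_point -` A = {}")
  case False
  then obtain c where c: "cantor_point c \<in> A" by blast
  have "b j = c j" if "cantor_point b \<in> A" "j < n" for b j
  proof (rule ccontr)
    assume "b j \<noteq> c j"
    from cantor_coordinate_separated[where b = b and b' = c, OF this that(2)] d[OF that(1) c] show False
      by (simp add: cantor_point_nth)
  qed
  then have "cantor_point -` A \<inter> space coin_sequences \<subseteq> {b. \<forall>j<n. b j = c j}" by auto
  then have "emeasure coin_sequences (cantor_point -` A \<inter> space coin_sequences)
      \<le> emeasure coin_sequences {b. \<forall>j<n. b j = c j}"
    by (intro emeasure_mono emeasure_cylinder(2))
  then show ?thesis
    unfolding cantor_measure_def
    by (simp only: emeasure_distr[OF measurable_cantor_point A] emeasure_cylinder(1))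
qed (simp add: cantor_measure_def emeasure_distr[OF measurable_cantor_point A])

lemma content_square: "l > 0 \<Longrightarrow> measure lborel (cbox a (a + vec l) :: (real^2) set) = l\<^sup>2"
  by (subst content_cbox_cart) (auto simp: interval_eq_empty_cart power2_eq_square prod_2 UNIV_2)

text \<open>
  For a square of side \<open>l\<close> take the first \<open>n\<close> with
  \<open>gap n \<le> 2 * l\<close>. Minimality bounds the mass of the square by
  \<open>2 powr (- n)\<close>, while the defining inequality bounds its logarithmic factor by
  \<open>35 * 2 ^ n\<close>: since \<open>l\<close> is at least \<open>2 powr (- 16 * 2 ^ n - 1)\<close> and
  \<open>ln 2 < 1\<close>, the factor is at most \<open>1 + 2 * (16 * 2 ^ n + 1)\<close>.
\<close>

lemma cantor_measure_log_morrey: "measure cantor_measure \<in> log_morrey 1"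
proof -
  interpret prob_space cantor_measure by (rule prob_space_cantor_measure)
  note fin = finite_measure_axioms sets_cantor_measure
  have bound: "ennreal ((1 - min (ln (measure lborel Q)) 0) powr 1) * total_variation (measure cantor_measure) Q
      \<le> ennreal 35" if "Q \<in> squares" for Q
  proof -
    obtain a l where Q: "Q = cbox a (a + vec l)" and l: "l > 0"
      using \<open>Q \<in> squares\<close> by (auto simp: squares_def)
    have "\<forall>\<^sub>F n in sequentially. gap n < 2 * l"
      using l by (intro order_tendstoD[OF gap_tendsto_0]) simp
    then have ex: "\<exists>n. gap n \<le> 2 * l"
      by (auto simp: eventually_sequentially intro: less_imp_le)
    define n where "n = (LEAST n. gap n \<le> 2 * l)"
    have n: "gap n \<le> 2 * l"
      unfolding n_def using ex by (rule LeastI_ex)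
    have less: "gap m > 2 * l" if "m < n" for m
      using not_less_Least[OF that[unfolded n_def]] by simp
    have Q_le: "emeasure cantor_measure Q \<le> ennreal ((1 / 2) ^ n)"
    proof (cases "n = 0")
      case True
      then show ?thesis using measure_le_1 by simp
    next
      case False
      have "\<bar>x $ 1 - y $ 1\<bar> \<le> l" if "x \<in> Q" "y \<in> Q" for x y
      proof -
        have "a $ 1 \<le> x $ 1" "x $ 1 \<le> a $ 1 + l" "a $ 1 \<le> y $ 1" "y $ 1 \<le> a $ 1 + l"
          using that by (auto simp: Q mem_box_cart)
        then show ?thesis by simp
      qed
      moreover have "l < gap (n - 1) / 2" using less[of "n - 1"] False by simp
      ultimately show ?thesis
        by (intro cantor_measure_diameter) (auto simp only: Q borel_closed closed_cbox intro: le_less_trans)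
    qed
    have "(1 / 2) ^ (gap_exponent n + 1) \<le> l"
      using n by (simp add: gap_def)
    then have "((1 / 2) ^ (gap_exponent n + 1))\<^sup>2 \<le> l\<^sup>2"
      by (intro power_mono) auto
    then have "ln (((1 / 2 :: real) ^ (gap_exponent n + 1))\<^sup>2) \<le> ln (l\<^sup>2)"
      using l by (subst ln_le_cancel_iff) auto
    moreover have "ln (((1 / 2 :: real) ^ (gap_exponent n + 1))\<^sup>2) = - (2 * (real (gap_exponent n) + 1) * ln 2)"
      by (simp add: ln_realpow ln_div algebra_simps flip: power_mult)
    moreover have "2 * (real (gap_exponent n) + 1) * ln 2 \<le> 2 * (real (gap_exponent n) + 1) * 1"
      using ln_2_less_1 by (intro mult_left_mono) auto
    ultimately have "1 - min (ln (l\<^sup>2)) 0 \<le> 3 + 32 * 2 ^ n"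
      by (auto simp: gap_exponent_def min_def)
    also have "\<dots> \<le> 35 * 2 ^ n" by simp
    finally have log_le: "1 - min (ln (l\<^sup>2)) 0 \<le> 35 * 2 ^ n" .
    have "total_variation (measure cantor_measure) Q \<le> ennreal ((1 / 2) ^ n)"
      using Q_le by (subst total_variation_measure[OF fin]) (auto simp: Q)
    moreover have "(1 - min (ln (measure lborel Q)) 0) powr 1 \<le> 35 * 2 ^ n"
      using log_le content_square[OF l] by (simp add: Q min_def)
    ultimately have "ennreal ((1 - min (ln (measure lborel Q)) 0) powr 1) * total_variation (measure cantor_measure) Q
      \<le> ennreal (35 * 2 ^ n) * ennreal ((1 / 2) ^ n)"
      by (intro mult_mono ennreal_leI) auto
    also have "\<dots> = ennreal 35"
      by (subst ennreal_mult[symmetric]) (auto simp: power_divide)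
    finally show ?thesis .
  qed
  have "log_morrey_norm 1 (measure cantor_measure) \<le> ennreal 35"
    unfolding log_morrey_norm_def by (intro SUP_least bound)
  also have "\<dots> < \<infinity>" by simp
  finally show ?thesis
    using signed_radon_measure_measure[OF fin] by (simp add: log_morrey_def)
qed

section \<open>Bumps of bounded energy around the Cantor set\<close>

text \<open>
  Exponents of the \<open>2 ^ n\<close> dyadic sizes at which the pieces of generation \<open>n\<close>
  are covered by bumps. The range lies between the exponents \<open>8 * 2 ^ n\<close> and
  \<open>16 * 2 ^ n\<close> of \<open>gap (n - 1)\<close> and \<open>gap n\<close>. A bump is therefore much larger
  than the piece that it covers, whose diameter is at most \<open>2 * gap n\<close>, and much smaller than
  the distance to any other piece of its generation, which is at least \<open>gap (n - 1) / 2\<close>.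
  Ranges of different generations are disjoint, so the scale determines the generation.
\<close>

definition scales :: "nat \<Rightarrow> nat set" where
  "scales n = {14 * 2 ^ n..<15 * 2 ^ n}"

lemma card_scales: "card (scales n) = 2 ^ n"
  by (simp add: scales_def)

lemma finite_scales: "finite (scales n)"
  by (simp add: scales_def)

lemma scales_mono:
  assumes "k \<in> scales n" "k' \<in> scales n'" "k \<le> k'"
  shows "n \<le> n'"
proof (rule ccontr)
  assume "\<not> n \<le> n'"
  then have "(2::nat) ^ Suc n' \<le> 2 ^ n" by (intro power_increasing) auto
  then show False using assms by (auto simp: scales_def)
qed

lemma scale_bounds:
  assumes "k \<in> scales n"
  shows "gap n \<le> (1 / 2) ^ k / 4" "n > 0 \<Longrightarrow> gap (n - 1) \<ge> 32 * (1 / 2) ^ k" "2 * n \<le> k"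
proof -
  have "(1::nat) \<le> 2 ^ n" by simp
  then have "k + 2 \<le> gap_exponent n"
    using assms unfolding scales_def gap_exponent_def by auto
  then have "gap n \<le> (1 / 2) ^ (k + 2)"
    unfolding gap_def by (intro power_decreasing) auto
  then show "gap n \<le> (1 / 2) ^ k / 4" by (simp add: power_add)
  show "gap (n - 1) \<ge> 32 * (1 / 2) ^ k" if "n > 0"
  proof -
    obtain m where m: "n = Suc m" using \<open>n > 0\<close> by (cases n) auto
    have "(1::nat) \<le> 2 ^ m" by simp
    then have "gap_exponent m + 5 \<le> k"
      using assms unfolding scales_def gap_exponent_def m by simp
    then have "(1 / 2 :: real) ^ k \<le> (1 / 2) ^ (gap_exponent m + 5)"
      by (intro power_decreasing) auto
    moreover have "(1 / 2 :: real) ^ (gap_exponent m + 5) = (1 / 2) ^ gap_exponent m / 32"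
      by (simp add: power_add power_divide)
    ultimately show ?thesis by (simp add: gap_def m)
  qed
  have "n < 2 ^ n" by (rule less_exp)
  then show "2 * n \<le> k"
    using assms unfolding scales_def atLeastLessThan_iff by linarith
qed

text \<open>
  Triples of a generation \<open>n\<close>, a scale exponent \<open>k\<close>, and the set \<open>S\<close>
  of those among the first \<open>n\<close> digits of a piece that are one.
\<close>

definition cell_index :: "nat \<Rightarrow> (nat \<times> nat \<times> nat set) set" where
  "cell_index N = (SIGMA n:{..<N}. scales n \<times> Pow {..<n})"

lemma finite_cell_index: "finite (cell_index N)"
  by (auto simp: cell_index_def finite_scales)

lemma sum_cell_index:
  "(\<Sum>(n, k, S)\<in>cell_index N. f n k S) = (\<Sum>n<N. \<Sum>k\<in>scales n. \<Sum>S\<in>Pow {..<n}. f n k S)"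
  unfolding cell_index_def by (simp add: sum.Sigma finite_scales sum.cartesian_product)

definition cell_center :: "nat set \<Rightarrow> real^2" where
  "cell_center S = cantor_point (\<lambda>j. j \<in> S)"

lemma cell_centers_separated:
  assumes "k \<in> scales n" "S \<subseteq> {..<n}" "T \<subseteq> {..<n}" "S \<noteq> T"
  shows "\<bar>cell_center S $ 1 - cell_center T $ 1\<bar> \<ge> 16 * (1 / 2) ^ k"
proof -
  obtain j where j: "(j \<in> S) \<noteq> (j \<in> T)" "j < n"
    using assms by blast
  then show ?thesis
    using cantor_coordinate_separated[of "\<lambda>j. j \<in> S" j "\<lambda>j. j \<in> T" n] scale_bounds(2)[OF assms(1)]
    by (simp add: cell_center_def cantor_point_nth)
qed

lemma cell_center_truncate:
  assumes "k \<in> scales n"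
  shows "\<bar>cantor_point b $ i - cell_center {j. j < n \<and> b j} $ i\<bar> \<le> (1 / 2) ^ k / 2"
  using cantor_coordinate_close[of n b "\<lambda>j. j \<in> {j. j < n \<and> b j}"] scale_bounds(1)[OF assms]
  by (simp add: cell_center_def cantor_point_nth)

text \<open>
  The point \<open>x\<close> is assumed to lie in the annulus of the larger bump and in the support of
  the smaller one. The piece of generation \<open>n\<close> that contains the smaller centre is either
  a piece different from that of \<open>S\<close>, which is then too far away, or the same one. In the
  latter case a strictly smaller scale is impossible: measured in units of the larger scale, half of
  the outer radius 4 plus the size of the piece is less than the inner radius 3, so the smaller bump
  lies where the larger is constant.
\<close>

lemma cell_annuli_disjoint:
  assumes i: "k \<in> scales n" "S \<subseteq> {..<n}" and i': "k' \<in> scales n'" "S' \<subseteq> {..<n'}" and le: "k \<le> k'"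
    and x: "\<And>j. \<bar>(x - cell_center S) $ j\<bar> \<le> 4 * (1 / 2) ^ k"
      "\<exists>j. \<bar>(x - cell_center S) $ j\<bar> \<ge> 3 * (1 / 2) ^ k"
    and x': "\<And>j. \<bar>(x - cell_center S') $ j\<bar> \<le> 4 * (1 / 2) ^ k'"
  shows "(n, k, S) = (n', k', S')"
proof -
  let ?h = "(1 / 2 :: real) ^ k"
  have h': "(1 / 2 :: real) ^ k' \<le> ?h" using le by (intro power_decreasing) auto
  have h: "?h > 0" by simp
  \<comment> \<open>The piece of the coarser generation \<open>n\<close> that contains the centre of the smaller bump.\<close>
  define T where "T = {j. j < n \<and> j \<in> S'}"
  have T: "\<bar>cell_center S' $ j - cell_center T $ j\<bar> \<le> ?h / 2" for j
    using cell_center_truncate[OF i(1), of "\<lambda>j. j \<in> S'" j] by (simp add: T_def cell_center_def)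
  have "S = T"
  proof (rule ccontr)
    assume "S \<noteq> T"
    then have "\<bar>cell_center S $ 1 - cell_center T $ 1\<bar> \<ge> 16 * ?h"
      using i by (intro cell_centers_separated) (auto simp: T_def)
    then show False
      using x(1)[of 1] x'[of 1] T[of 1] h h' unfolding vector_minus_component by linarith
  qed
  have "k = k'"
  proof (rule ccontr)
    assume "k \<noteq> k'"
    then have "(1 / 2 :: real) ^ k' \<le> (1 / 2) ^ Suc k" using le by (intro power_decreasing) auto
    then have h': "(1 / 2 :: real) ^ k' \<le> ?h / 2" by simp
    obtain j where "\<bar>(x - cell_center S) $ j\<bar> \<ge> 3 * ?h" using x(2) by blast
    then show False
      using x'[of j] T[of j, folded \<open>S = T\<close>] h h' unfolding vector_minus_component by linarith
  qed
  moreover have "n = n'"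
    using scales_mono i(1) i'(1) \<open>k = k'\<close> by (intro antisym) auto
  moreover have "T = S'" using i'(2) \<open>n = n'\<close> by (auto simp: T_def)
  ultimately show ?thesis using \<open>S = T\<close> by simp
qed

lemma cell_gradients_disjoint:
  assumes "(n, k, S) \<in> cell_index N" "(n', k', S') \<in> cell_index N"
    and "partial i plane_bump (2 ^ k *\<^sub>R (x - cell_center S)) \<noteq> 0"
    and "partial i plane_bump (2 ^ k' *\<^sub>R (x - cell_center S')) \<noteq> 0"
  shows "(n, k, S) = (n', k', S')"
proof -
  have rescale: "\<bar>(2 ^ k *\<^sub>R y) $ j\<bar> = \<bar>y $ j\<bar> * 2 ^ k" for k j and y :: "real^2"
    by (simp add: abs_mult)
  have *: "\<bar>(x - cell_center S) $ j\<bar> \<le> 4 * (1 / 2) ^ k"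
      "\<exists>j. \<bar>(x - cell_center S) $ j\<bar> \<ge> 3 * (1 / 2) ^ k"
    if "partial i plane_bump (2 ^ k *\<^sub>R (x - cell_center S)) \<noteq> 0" for k S j
    using partial_plane_bump_support[OF that] unfolding rescale
    by (simp_all add: field_simps power_divide)
  have i: "k \<in> scales n" "S \<subseteq> {..<n}" "k' \<in> scales n'" "S' \<subseteq> {..<n'}"
    using assms by (auto simp: cell_index_def)
  show ?thesis
  proof (cases "k \<le> k'")
    case True
    then show ?thesis
      by (intro cell_annuli_disjoint[OF i]) (use *[OF assms(3)] *[OF assms(4)] in auto)
  next
    case False
    then have "(n', k', S') = (n, k, S)"
      by (intro cell_annuli_disjoint[OF i(3,4,1,2)]) (use *[OF assms(3)] *[OF assms(4)] in auto)
    then show ?thesis by simp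
  qed
qed

text \<open>
  The weight \<open>(1 / 2) ^ n\<close> averages over the \<open>2 ^ n\<close> scales of generation
  \<open>n\<close>. Each generation thus contributes a smooth version of a logarithmic cutoff around
  every piece, that is, of its capacitary potential.
\<close>

definition multiscale_bump :: "nat \<Rightarrow> real^2 \<Rightarrow> real" where
  "multiscale_bump N x =
     (\<Sum>(n, k, S)\<in>cell_index N. (1 / 2) ^ n * plane_bump (2 ^ k *\<^sub>R (x - cell_center S)))"

lemma multiscale_bump_test_function: "multiscale_bump N \<in> test_functions"
proof -
  have "(\<lambda>x. \<Sum>j\<in>cell_index N. (1 / 2) ^ fst j *
      plane_bump (2 ^ fst (snd j) *\<^sub>R (x - cell_center (snd (snd j))))) \<in> test_functions"
    by (intro test_function_linear_combination finite_cell_index test_function_affine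
        plane_bump_test_function) simp
  then show ?thesis by (simp add: multiscale_bump_def[abs_def] split_def)
qed

lemma partial_multiscale_bump:
  "partial i (multiscale_bump N) x =
     (\<Sum>(n, k, S)\<in>cell_index N. (1 / 2) ^ n * 2 ^ k * partial i plane_bump (2 ^ k *\<^sub>R (x - cell_center S)))"
proof -
  have d: "plane_bump differentiable at y" for y
    by (intro test_function_differentiable plane_bump_test_function)
  have "partials [i] (\<lambda>x. \<Sum>j\<in>cell_index N. (1 / 2) ^ fst j *
      plane_bump (2 ^ fst (snd j) *\<^sub>R (x - cell_center (snd (snd j)))))
    = (\<lambda>x. \<Sum>j\<in>cell_index N. (1 / 2) ^ fst j * partials [i]
      (\<lambda>x. plane_bump (2 ^ fst (snd j) *\<^sub>R (x - cell_center (snd (snd j))))) x)"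
    by (intro partials_linear_combination finite_cell_index test_function_differentiable(1)
        test_function_affine plane_bump_test_function) simp
  then show ?thesis
    by (simp add: multiscale_bump_def[abs_def] split_def partial_affine(2)[OF d] mult.assoc)
qed

lemma sum_power2_at_most_one:
  fixes f :: "'a \<Rightarrow> real"
  assumes "finite J" "\<And>a b. a \<in> J \<Longrightarrow> b \<in> J \<Longrightarrow> f a \<noteq> 0 \<Longrightarrow> f b \<noteq> 0 \<Longrightarrow> a = b"
  shows "(\<Sum>a\<in>J. f a)\<^sup>2 = (\<Sum>a\<in>J. (f a)\<^sup>2)"
proof -
  have "(\<Sum>a\<in>J. f a)\<^sup>2 = (\<Sum>a\<in>J. \<Sum>b\<in>J. f a * f b)"
    by (simp add: power2_eq_square sum_product)
  also have "\<dots> = (\<Sum>a\<in>J. \<Sum>b\<in>J. if b = a then (f a)\<^sup>2 else 0)"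
    using assms(2) by (intro sum.cong) (auto simp: power2_eq_square)
  finally show ?thesis using assms(1) by simp
qed

lemma measurable_test_function:
  assumes "f \<in> test_functions"
  shows "f \<in> borel_measurable borel" "partial i f \<in> borel_measurable borel"
  using assms by (auto intro!: borel_measurable_continuous_onI continuous_test_function continuous_partial)

lemma integrable_rescaled_square:
  assumes "f \<in> test_functions" "c > 0"
  shows "integrable lborel (\<lambda>x. (f (c *\<^sub>R (x - z)))\<^sup>2)"
    "integrable lborel (\<lambda>x. (partial i f (c *\<^sub>R (x - z)))\<^sup>2)"
proof -
  have g: "(\<lambda>x. f (c *\<^sub>R (x - z))) \<in> test_functions"
    using assms by (rule test_function_affine)
  show "integrable lborel (\<lambda>x. (f (c *\<^sub>R (x - z)))\<^sup>2)"
    using test_function_integrable_square(1)[OF g] .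
  have "integrable lborel (\<lambda>x. (c * partial i f (c *\<^sub>R (x - z)))\<^sup>2)"
    using test_function_integrable_square(2)[OF g, of i] assms(1)
    by (simp add: partial_affine(2) test_function_differentiable)
  then have "integrable lborel (\<lambda>x. (1 / c\<^sup>2) * (c * partial i f (c *\<^sub>R (x - z)))\<^sup>2)"
    by (rule integrable_mult_right)
  with assms(2) show "integrable lborel (\<lambda>x. (partial i f (c *\<^sub>R (x - z)))\<^sup>2)"
    by (simp add: power_mult_distrib)
qed

text \<open>
  Generation \<open>n\<close> has \<open>2 ^ n\<close> scales and \<open>2 ^ n\<close> pieces, so the squares
  of the weights add up to one in each generation.
\<close>

lemma sum_cell_weights: "(\<Sum>(n, k, S)\<in>cell_index N. (1 / 4) ^ n) = real N"
proof -
  have "(2::real) ^ n * (2 ^ n * (1 / 4) ^ n) = 1" for n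
    by (simp flip: power_mult_distrib)
  then show ?thesis
    by (simp add: sum_cell_index card_scales card_Pow)
qed

text \<open>
  At most one of the gradients is nonzero at each point, so the energies add up without mixed
  terms. Each energy is independent of scale, and only the squares of the weights remain.
\<close>

lemma multiscale_bump_gradient:
  "(\<integral>x. (partial i (multiscale_bump N) x)\<^sup>2 \<partial>lborel) = real N * (\<integral>x. (partial i plane_bump x)\<^sup>2 \<partial>lborel)"
proof -
  let ?g = "\<lambda>(n, k, S) x. (1 / 2) ^ n * 2 ^ k * partial i plane_bump (2 ^ k *\<^sub>R (x - cell_center S))"
  let ?D = "\<integral>x. (partial i plane_bump x)\<^sup>2 \<partial>lborel"
  have [measurable]: "partial i plane_bump \<in> borel_measurable borel"
    by (intro measurable_test_function plane_bump_test_function)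
  have "(partial i (multiscale_bump N) x)\<^sup>2 = (\<Sum>j\<in>cell_index N. (?g j x)\<^sup>2)" for x
  proof -
    have "partial i (multiscale_bump N) x = (\<Sum>j\<in>cell_index N. ?g j x)"
      by (simp add: partial_multiscale_bump split_def)
    also have "\<dots>\<^sup>2 = (\<Sum>j\<in>cell_index N. (?g j x)\<^sup>2)"
    proof (rule sum_power2_at_most_one[OF finite_cell_index])
      fix a b assume "a \<in> cell_index N" "b \<in> cell_index N" "?g a x \<noteq> 0" "?g b x \<noteq> 0"
      then show "a = b"
        using cell_gradients_disjoint[of "fst a" "fst (snd a)" "snd (snd a)" N
            "fst b" "fst (snd b)" "snd (snd b)" i x] by (simp add: split_def)
    qed
    finally show ?thesis .
  qed
  then have "(\<integral>x. (partial i (multiscale_bump N) x)\<^sup>2 \<partial>lborel)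
      = (\<integral>x. (\<Sum>j\<in>cell_index N. (?g j x)\<^sup>2) \<partial>lborel)" by simp
  also have "\<dots> = (\<Sum>j\<in>cell_index N. \<integral>x. (?g j x)\<^sup>2 \<partial>lborel)"
    by (intro Bochner_Integration.integral_sum)
       (auto simp: power_mult_distrib split_def
         intro!: integrable_mult_right integrable_rescaled_square plane_bump_test_function)
  also have "\<dots> = (\<Sum>(n, k, S)\<in>cell_index N. (1 / 4) ^ n * ?D)"
  proof (rule sum.cong[OF refl], clarify)
    fix n k S
    have "(\<integral>x. (partial i plane_bump (2 ^ k *\<^sub>R (x - cell_center S)))\<^sup>2 \<partial>lborel) = ?D / (2 ^ k)\<^sup>2"
      by (rule integral_lborel_rescale) auto
    moreover have "((1 / 2 :: real) ^ n)\<^sup>2 = (1 / 4) ^ n"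
      by (simp add: power2_eq_square flip: power_mult_distrib)
    ultimately show "(\<integral>x. ((1 / 2) ^ n * 2 ^ k * partial i plane_bump (2 ^ k *\<^sub>R (x - cell_center S)))\<^sup>2 \<partial>lborel)
        = (1 / 4) ^ n * ?D"
      by (simp add: power_mult_distrib)
  qed
  also have "\<dots> = real N * ?D"
    unfolding sum_cell_weights[symmetric] by (simp add: sum_distrib_right split_def)
  finally show ?thesis .
qed

lemma sum_cell_areas: "(\<Sum>(n, k, S)\<in>cell_index N. (1 / 4) ^ k) \<le> (2 :: real)"
proof -
  have "(\<Sum>(n, k, S)\<in>cell_index N. (1 / 4 :: real) ^ k) = (\<Sum>n<N. \<Sum>k\<in>scales n. 2 ^ n * (1 / 4) ^ k)"
    by (simp add: sum_cell_index card_Pow)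
  also have "\<dots> \<le> (\<Sum>n<N. \<Sum>k\<in>scales n. 2 ^ n * (1 / 4) ^ (2 * n))"
    by (intro sum_mono mult_left_mono power_decreasing scale_bounds(3)) auto
  also have "\<dots> = (\<Sum>n<N. (1 / 4) ^ n)"
  proof -
    have "(2::real) ^ n * (2 ^ n * (1 / 4) ^ (2 * n)) = (1 / 4) ^ n" for n
    proof -
      have "(1 / 4 :: real) ^ (2 * n) = (1 / 16) ^ n"
        by (simp add: power_mult power2_eq_square)
      then show ?thesis by (simp flip: power_mult_distrib)
    qed
    then show ?thesis by (simp add: card_scales)
  qed
  also have "\<dots> \<le> 2"
  proof -
    have "0 \<le> (1 / 4 :: real) ^ N" by simp
    then have "- ((1 / 4 :: real) ^ N * 4) \<le> 2" by linarith
    then show ?thesis by (subst sum_gp_strict) (simp add: pos_divide_le_eq)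
  qed
  finally show ?thesis .
qed

text \<open>
  The Cauchy-Schwarz inequality against the weights costs a factor \<open>N\<close>, but the areas of
  all the cells together stay bounded.
\<close>

lemma multiscale_bump_L2:
  "(\<integral>x. (multiscale_bump N x)\<^sup>2 \<partial>lborel) \<le> real N * (2 * (\<integral>x. (plane_bump x)\<^sup>2 \<partial>lborel))"
proof -
  let ?b = "\<lambda>(n, k, S) x. plane_bump (2 ^ k *\<^sub>R (x - cell_center S))"
  let ?D = "\<integral>x. (plane_bump x)\<^sup>2 \<partial>lborel"
  have [measurable]: "plane_bump \<in> borel_measurable borel"
    by (intro measurable_test_function plane_bump_test_function)
  have int: "integrable lborel (\<lambda>x. (?b j x)\<^sup>2)" for j
    by (auto simp: split_def intro!: integrable_rescaled_square plane_bump_test_function)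
  have "(multiscale_bump N x)\<^sup>2 \<le> real N * (\<Sum>j\<in>cell_index N. (?b j x)\<^sup>2)" for x
  proof -
    have "(multiscale_bump N x)\<^sup>2 = (\<Sum>j\<in>cell_index N. (1 / 2) ^ fst j * ?b j x)\<^sup>2"
      by (simp add: multiscale_bump_def split_def)
    \<comment> \<open>The weights go into the first factor, which is then \<open>N\<close> and not the number of
      cells, which is exponential in \<open>N\<close>.\<close>
    also have "\<dots> \<le> (\<Sum>j\<in>cell_index N. ((1 / 2) ^ fst j)\<^sup>2) * (\<Sum>j\<in>cell_index N. (?b j x)\<^sup>2)"
      by (rule Cauchy_Schwarz_ineq_sum)
    also have "(\<Sum>j\<in>cell_index N. ((1 / 2) ^ fst j)\<^sup>2) = real N"
      unfolding sum_cell_weights[symmetric]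
      by (simp add: split_def power2_eq_square flip: power_mult_distrib)
    finally show ?thesis .
  qed
  then have "(\<integral>x. (multiscale_bump N x)\<^sup>2 \<partial>lborel) \<le> (\<integral>x. real N * (\<Sum>j\<in>cell_index N. (?b j x)\<^sup>2) \<partial>lborel)"
    by (intro integral_mono test_function_integrable_square multiscale_bump_test_function
        integrable_mult_right Bochner_Integration.integrable_sum int)
  also have "\<dots> = real N * (\<Sum>j\<in>cell_index N. \<integral>x. (?b j x)\<^sup>2 \<partial>lborel)"
    by (simp only: integral_mult_right_zero Bochner_Integration.integral_sum[OF int])
  also have "(\<Sum>j\<in>cell_index N. \<integral>x. (?b j x)\<^sup>2 \<partial>lborel) = (\<Sum>(n, k, S)\<in>cell_index N. (1 / 4) ^ k * ?D)"
  proof (rule sum.cong[OF refl], clarify)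
    fix n k S
    have "(\<integral>x. (plane_bump (2 ^ k *\<^sub>R (x - cell_center S)))\<^sup>2 \<partial>lborel) = ?D / (2 ^ k)\<^sup>2"
      by (rule integral_lborel_rescale) auto
    also have "((2::real) ^ k)\<^sup>2 = 4 ^ k"
      by (simp add: power2_eq_square flip: power_mult_distrib)
    finally show "(\<integral>x. (plane_bump (2 ^ k *\<^sub>R (x - cell_center S)))\<^sup>2 \<partial>lborel) = (1 / 4) ^ k * ?D"
      by (simp add: power_divide)
  qed
  also have "\<dots> = (\<Sum>(n, k, S)\<in>cell_index N. (1 / 4) ^ k) * ?D"
    by (simp add: sum_distrib_right split_def)
  also have "real N * \<dots> \<le> real N * (2 * ?D)"
    by (intro mult_left_mono mult_right_mono sum_cell_areas) auto
  finally show ?thesis .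
qed

text \<open>
  In every generation and at every scale, the bump around the piece that contains the point takes
  the value one there, and the averaged bumps of one generation sum to at least one.
\<close>

lemma multiscale_bump_on_cantor_set: "multiscale_bump N (cantor_point b) \<ge> real N"
proof -
  let ?f = "\<lambda>n k S. (1 / 2) ^ n * plane_bump (2 ^ k *\<^sub>R (cantor_point b - cell_center S))"
  have "real N = (\<Sum>n<N. \<Sum>k\<in>scales n. (1 / 2) ^ n)"
    by (simp add: card_scales power_one_over)
  also have "\<dots> \<le> (\<Sum>n<N. \<Sum>k\<in>scales n. \<Sum>S\<in>Pow {..<n}. ?f n k S)"
  proof (intro sum_mono)
    fix n k assume k: "k \<in> scales n"
    let ?T = "{j. j < n \<and> b j}"
    have "\<bar>(2 ^ k *\<^sub>R (cantor_point b - cell_center ?T)) $ i\<bar> \<le> 3" for i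
      using mult_left_mono[OF cell_center_truncate[OF k, of b i], of "2 ^ k"]
      by (simp add: abs_mult power_divide)
    then have "plane_bump (2 ^ k *\<^sub>R (cantor_point b - cell_center ?T)) = 1"
      by (rule plane_bump(2))
    then have "(1 / 2) ^ n = ?f n k ?T" by simp
    also have "\<dots> \<le> (\<Sum>S\<in>Pow {..<n}. ?f n k S)"
      using plane_bump(1) by (intro member_le_sum) auto
    finally show "(1 / 2) ^ n \<le> (\<Sum>S\<in>Pow {..<n}. ?f n k S)" .
  qed
  also have "\<dots> = multiscale_bump N (cantor_point b)"
    by (simp add: multiscale_bump_def sum_cell_index)
  finally show ?thesis .
qed

lemma multiscale_bump_integral:
  "(\<integral>x. plane_bump x * multiscale_bump N x \<partial>cantor_measure) \<ge> real N"
proof -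
  interpret prob_space cantor_measure by (rule prob_space_cantor_measure)
  let ?u = "multiscale_bump N"
  have [measurable]: "plane_bump \<in> borel_measurable borel" "?u \<in> borel_measurable borel"
    by (intro measurable_test_function plane_bump_test_function multiscale_bump_test_function)+
  note [measurable_cong] = sets_cantor_measure
  have one: "plane_bump (cantor_point b) = 1" for b
    using cantor_coordinate_range[of b] by (intro plane_bump(2)) (auto simp: cantor_point_nth)
  have "integrable cantor_measure ?u"
  proof (rule integrable_const_bound)
    show "AE x in cantor_measure. norm (?u x) \<le> (SUP x. \<bar>?u x\<bar>)"
      using cSUP_upper[OF UNIV_I bdd_above_test_function[OF multiscale_bump_test_function]] by simp
  qed measurable
  then have "(\<integral>x. real N \<partial>cantor_measure) \<le> (\<integral>x. ?u x \<partial>cantor_measure)"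
    using AE_cantor_measure multiscale_bump_on_cantor_set
    by (intro integral_mono_AE) auto
  also have "\<dots> = (\<integral>x. plane_bump x * ?u x \<partial>cantor_measure)"
    using AE_cantor_measure by (intro integral_cong_AE) (auto simp: one)
  finally show ?thesis by (simp add: prob_space)
qed

text \<open>
  The integrals of the multiscale bumps grow like \<open>N\<close>, but their Sobolev norms only like
  \<open>sqrt N\<close>. The factor \<open>plane_bump\<close> is a cutoff equal to one on the Cantor set.
\<close>

lemma cantor_measure_not_H_minus1_loc: "distr_of_measure cantor_measure \<notin> H_minus1_loc"
proof
  assume "distr_of_measure cantor_measure \<in> H_minus1_loc"
  then have "distr_mult plane_bump (distr_of_measure cantor_measure) \<in> H_minus1"
    by (auto simp: H_minus1_loc_def plane_bump_test_function)
  then obtain C where C: "\<And>u. u \<in> test_functions \<Longrightarrow>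
      \<bar>distr_mult plane_bump (distr_of_measure cantor_measure) u\<bar> \<le> C *
      sqrt ((\<integral>x. (u x)\<^sup>2 \<partial>lborel) + (\<Sum>i\<in>UNIV. \<integral>x. (partial i u x)\<^sup>2 \<partial>lborel))"
    using H_minus1_bound by metis
  define A where "A = 2 * (\<integral>x. (plane_bump x)\<^sup>2 \<partial>lborel)
    + (\<Sum>i\<in>UNIV. \<integral>x. (partial i plane_bump x)\<^sup>2 \<partial>lborel)"
  have bound: "real N \<le> C\<^sup>2 * A" if "N > 0" for N
  proof -
    let ?u = "multiscale_bump N"
    let ?E = "(\<integral>x. (?u x)\<^sup>2 \<partial>lborel) + (\<Sum>i\<in>UNIV. \<integral>x. (partial i ?u x)\<^sup>2 \<partial>lborel)"
    have E: "?E \<le> real N * A" "?E \<ge> 0"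
      using multiscale_bump_L2[of N]
      by (simp_all add: multiscale_bump_gradient A_def distrib_left sum_distrib_left sum_nonneg)
    have "real N \<le> (\<integral>x. plane_bump x * ?u x \<partial>cantor_measure)"
      by (rule multiscale_bump_integral)
    also have "\<dots> \<le> C * sqrt ?E"
      using C[OF multiscale_bump_test_function[of N]]
      by (simp add: distr_mult_def distr_of_measure_def)
    finally have "(real N)\<^sup>2 \<le> (C * sqrt ?E)\<^sup>2" by (intro power_mono) auto
    also have "\<dots> \<le> C\<^sup>2 * (real N * A)"
      using E by (simp add: power_mult_distrib mult_left_mono)
    finally show ?thesis using that by (simp add: power2_eq_square mult.left_commute)
  qed
  obtain N where "real N > C\<^sup>2 * A" using reals_Archimedean2 by blast
  moreover have "real (Suc N) \<le> C\<^sup>2 * A" by (rule bound) simp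
  ultimately show False by simp
qed

theorem theorem1p3:
  shows "\<exists>(E :: (real^2) set) (\<omega> :: (real^2) measure).
           cantor_set E \<and> E \<subseteq> cbox (vec 0) (vec 1) \<and>
           radon_measure \<omega> \<and> prob_space \<omega> \<and> measure \<omega> E = 1 \<and>
           measure \<omega> \<in> log_morrey 1 \<and>
           distr_of_measure \<omega> \<notin> H_minus1_loc"
proof (intro exI conjI)
  show "cantor_set (range cantor_point)" by (rule cantor_set_range)
  show "range cantor_point \<subseteq> cbox (vec 0) (vec 1)"
    using cantor_point_in_square by blast
  show "prob_space cantor_measure" by (rule prob_space_cantor_measure)
  then show "radon_measure cantor_measure"
    by (intro radon_measure_finite sets_cantor_measure prob_space.finite_measure)
  show "measure cantor_measure (range cantor_point) = 1" by (rule measure_cantor_set)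
  show "measure cantor_measure \<in> log_morrey 1" by (rule cantor_measure_log_morrey)
  show "distr_of_measure cantor_measure \<notin> H_minus1_loc" by (rule cantor_measure_not_H_minus1_loc)
qed

end
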